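(* Let $a>0$, $b>0$. The space of signed measures $(\mathcal{M}^s(\mathbb{R}^d),\|\cdot\|^{a,b})$ is a normed vector space.
   Context: $\mathcal{M}(\mathbb{R}^d)$ is the set of positive Borel (Radon) measures on $\mathbb{R}^d$ with finite mass; $\mathcal{M}^s(\mathbb{R}^d)$ is the vector space of signed measures $\mu=\mu_+-\mu_-$ with $\mu_\pm\in\mathcal{M}(\mathbb{R}^d)$; $|\mu|$ denotes the total mass (total variation) of $\mu$. For $\tilde\mu,\tilde\nu\in\mathcal{M}(\mathbb{R}^d)$ of equal mass, $W_1(\tilde\mu,\tilde\nu)=\min_{\pi}\int|x-y|\,d\pi(x,y)$ over positive measures $\pi$ on $\mathbb{R}^d\times\mathbb{R}^d$ with marginals $\tilde\mu,\tilde\nu$. For $\mu,\nu\in\mathcal{M}(\mathbb{R}^d)$, $$W_1^{a,b}(\mu,\nu)=\inf\{a(|\mu-\tilde\mu|+|\nu-\tilde\nu|)+bW_1(\tilde\mu,\tilde\nu):\ \tilde\mu,\tilde\nu\in\mathcal{M}(\mathbb{R}^d),\ |\tilde\mu|=|\tilde\nu|\}.$$ For $\mu\in\mathcal{M}^s(\mathbb{R}^d)$, $\|\mu\|^{a,b}=W_1^{a,b}(\mu_+,\mu_-)$, where $\mu_+,\mu_-$ are any measures in $\mathcal{M}(\mathbb{R}^d)$ with $\mu=\mu_+-\mu_-$ (the value does not depend on the choice). *)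

theory Defs
  imports "HOL-Analysis.Analysis"
begin

text \<open>On a Euclidean space every finite Borel measure is automatically Radon.\<close>

definition finite_borel :: "'a::euclidean_space measure set" where
  "finite_borel = {M. sets M = sets borel \<and> finite_measure M}"

lemma null_measure_finite_borel: "null_measure borel \<in> finite_borel"
  by (auto simp: finite_borel_def intro!: finite_measureI)

lemma ex_add_finite_borel:
  assumes "M \<in> finite_borel" "N \<in> finite_borel"
  shows "\<exists>L\<in>finite_borel. \<forall>A. measure L A = measure M A + measure N A"
proof -
  define L where "L = measure_of UNIV (sets borel) (\<lambda>A. emeasure M A + emeasure N A)"
  have sM: "sets M = sets borel" and sN: "sets N = sets borel"
    and fM: "finite_measure M" and fN: "finite_measure N"
    using assms by (auto simp: finite_borel_def)
  have sL: "sets L = sets borel"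
    unfolding L_def by (metis sets.sets_measure_of_eq space_borel)
  have eL: "emeasure L A = emeasure M A + emeasure N A" if "A \<in> sets borel" for A
  proof (rule emeasure_measure_of[OF L_def])
    show "countably_additive (sets L) (\<lambda>A. emeasure M A + emeasure N A)"
    proof (rule countably_additiveI)
      fix F :: "nat \<Rightarrow> 'a set"
      assume "range F \<subseteq> sets L" "disjoint_family F"
      then show "(\<Sum>i. emeasure M (F i) + emeasure N (F i)) =
          emeasure M (\<Union>i. F i) + emeasure N (\<Union>i. F i)"
        using sM sN sL by (simp add: suminf_add[symmetric] suminf_emeasure)
    qed
  qed (use that sL in \<open>auto simp: positive_def\<close>)
  have "space L = UNIV"
    using sL sets_eq_imp_space_eq space_borel by blast
  then have "finite_measure L"
    using fM fN eL by (intro finite_measureI) (auto simp: finite_measure.emeasure_finite)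
  moreover have "measure L A = measure M A + measure N A" for A
  proof (cases "A \<in> sets borel")
    case True
    moreover have "emeasure M A < top" "emeasure N A < top"
      using finite_measure.emeasure_finite[OF fM] finite_measure.emeasure_finite[OF fN]
      by (simp_all add: top.not_eq_extremum)
    ultimately show ?thesis
      by (simp add: measure_def eL enn2real_plus)
  next
    case False
    then show ?thesis by (simp add: measure_notin_sets sL sM sN)
  qed
  ultimately show ?thesis using sL by (auto simp: finite_borel_def)
qed

lemma ex_scale_finite_borel:
  assumes "M \<in> finite_borel" "0 \<le> r"
  shows "\<exists>L\<in>finite_borel. \<forall>A. measure L A = r * measure M A"
proof
  show "scale_measure (ennreal r) M \<in> finite_borel"
    using assms
    by (auto simp: finite_borel_def finite_measure.emeasure_finite ennreal_mult_eq_top_iff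
        intro!: finite_measureI)
  show "\<forall>A. measure (scale_measure (ennreal r) M) A = r * measure M A"
    using assms by (simp add: measure_def enn2real_mult)
qed

text \<open>
  A signed measure is represented by its set function. Since \<^const>\<open>measure\<close> vanishes on
  non-measurable sets, so do these functions, and equality in the type is equality on
  Borel sets.
\<close>

typedef (overloaded) 'a signed_measure =
  "{m :: 'a::euclidean_space set \<Rightarrow> real.
     \<exists>M\<in>finite_borel. \<exists>N\<in>finite_borel. m = (\<lambda>A. measure M A - measure N A)}"
  morphisms sm_apply Abs_signed_measure
  using null_measure_finite_borel by blast

definition sm_diff :: "'a::euclidean_space measure \<Rightarrow> 'a measure \<Rightarrow> 'a signed_measure" where
  "sm_diff M N = Abs_signed_measure (\<lambda>A. measure M A - measure N A)"

lemma sm_apply_sm_diff: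
  assumes "M \<in> finite_borel" "N \<in> finite_borel"
  shows "sm_apply (sm_diff M N) A = measure M A - measure N A"
  unfolding sm_diff_def using assms by (subst Abs_signed_measure_inverse) auto

lemma sm_eqI: "(\<And>A. sm_apply \<mu> A = sm_apply \<nu> A) \<Longrightarrow> \<mu> = \<nu>"
  using sm_apply_inject by blast

lemma sm_diff_cases:
  obtains M N where "M \<in> finite_borel" "N \<in> finite_borel" "\<mu> = sm_diff M N"
  using sm_apply[of \<mu>] sm_apply_inverse[of \<mu>] unfolding sm_diff_def by force

instantiation signed_measure :: (euclidean_space) real_vector
begin

definition zero_signed_measure :: "'a signed_measure" where
  "0 = Abs_signed_measure (\<lambda>A. 0)"

definition plus_signed_measure :: "'a signed_measure \<Rightarrow> 'a signed_measure \<Rightarrow> 'a signed_measure" where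
  "\<mu> + \<nu> = Abs_signed_measure (\<lambda>A. sm_apply \<mu> A + sm_apply \<nu> A)"

definition uminus_signed_measure :: "'a signed_measure \<Rightarrow> 'a signed_measure" where
  "- \<mu> = Abs_signed_measure (\<lambda>A. - sm_apply \<mu> A)"

definition minus_signed_measure :: "'a signed_measure \<Rightarrow> 'a signed_measure \<Rightarrow> 'a signed_measure" where
  "\<mu> - \<nu> = \<mu> + - (\<nu> :: 'a signed_measure)"

definition scaleR_signed_measure :: "real \<Rightarrow> 'a signed_measure \<Rightarrow> 'a signed_measure" where
  "r *\<^sub>R \<mu> = Abs_signed_measure (\<lambda>A. r * sm_apply \<mu> A)"

lemma sm_apply_zero: "sm_apply (0 :: 'a signed_measure) A = 0"
proof -
  have "(\<lambda>A::'a set. 0) = (\<lambda>A. measure (null_measure borel) A - measure (null_measure borel) A)"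
    by simp
  then show ?thesis
    unfolding zero_signed_measure_def using null_measure_finite_borel
    by (subst Abs_signed_measure_inverse) blast+
qed

lemma sm_apply_plus:
  "sm_apply (\<mu> + \<nu> :: 'a signed_measure) A = sm_apply \<mu> A + sm_apply \<nu> A"
proof -
  obtain M N where 1: "M \<in> finite_borel" "N \<in> finite_borel" "\<mu> = sm_diff M N"
    by (rule sm_diff_cases)
  obtain M' N' where 2: "M' \<in> finite_borel" "N' \<in> finite_borel" "\<nu> = sm_diff M' N'"
    by (rule sm_diff_cases)
  obtain K where K: "K \<in> finite_borel" "\<forall>A. measure K A = measure M A + measure M' A"
    using ex_add_finite_borel 1 2 by blast
  obtain L where L: "L \<in> finite_borel" "\<forall>A. measure L A = measure N A + measure N' A"
    using ex_add_finite_borel 1 2 by blast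
  have "(\<lambda>A. sm_apply \<mu> A + sm_apply \<nu> A) = (\<lambda>A. measure K A - measure L A)"
    using 1 2 K L by (auto simp: sm_apply_sm_diff)
  then show ?thesis
    unfolding plus_signed_measure_def using K(1) L(1)
    by (subst Abs_signed_measure_inverse) blast+
qed

lemma sm_apply_uminus: "sm_apply (- \<mu> :: 'a signed_measure) A = - sm_apply \<mu> A"
proof -
  obtain M N where 1: "M \<in> finite_borel" "N \<in> finite_borel" "\<mu> = sm_diff M N"
    by (rule sm_diff_cases)
  have "(\<lambda>A. - sm_apply \<mu> A) = (\<lambda>A. measure N A - measure M A)"
    using 1 by (auto simp: sm_apply_sm_diff)
  then show ?thesis
    unfolding uminus_signed_measure_def using 1(1,2)
    by (subst Abs_signed_measure_inverse) blast+
qed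

lemma sm_apply_scaleR: "sm_apply (r *\<^sub>R \<mu> :: 'a signed_measure) A = r * sm_apply \<mu> A"
proof -
  obtain M N where 1: "M \<in> finite_borel" "N \<in> finite_borel" "\<mu> = sm_diff M N"
    by (rule sm_diff_cases)
  obtain K where K: "K \<in> finite_borel" "\<forall>A. measure K A = \<bar>r\<bar> * measure M A"
    using ex_scale_finite_borel 1 abs_ge_zero by blast
  obtain L where L: "L \<in> finite_borel" "\<forall>A. measure L A = \<bar>r\<bar> * measure N A"
    using ex_scale_finite_borel 1 abs_ge_zero by blast
  have "(\<lambda>A. r * sm_apply \<mu> A) =
      (if r \<ge> 0 then (\<lambda>A. measure K A - measure L A) else (\<lambda>A. measure L A - measure K A))"
    using 1 K L by (auto simp: sm_apply_sm_diff algebra_simps)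
  then have "\<exists>M\<in>finite_borel. \<exists>N\<in>finite_borel.
      (\<lambda>A. r * sm_apply \<mu> A) = (\<lambda>A. measure M A - measure N A)"
    using K(1) L(1) by (cases "r \<ge> 0") auto
  then show ?thesis
    unfolding scaleR_signed_measure_def
    by (subst Abs_signed_measure_inverse) auto
qed

instance
  by standard
    (auto intro!: sm_eqI simp: minus_signed_measure_def sm_apply_zero sm_apply_plus
      sm_apply_uminus sm_apply_scaleR algebra_simps)

end

definition total_variation :: "'a::euclidean_space signed_measure \<Rightarrow> ennreal" where
  "total_variation \<mu> =
     (SUP A \<in> {A :: nat \<Rightarrow> 'a set. range A \<subseteq> sets borel \<and> disjoint_family A \<and> (\<Union>i. A i) = UNIV}.
        \<Sum>i. ennreal \<bar>sm_apply \<mu> (A i)\<bar>)"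

text \<open>
  The Wasserstein distance takes values in \<^typ>\<open>ennreal\<close>, because measures
  without a finite first moment may be at infinite distance.
\<close>

definition couplings :: "'a::euclidean_space measure \<Rightarrow> 'a measure \<Rightarrow> ('a \<times> 'a) measure set" where
  "couplings M N = {\<pi>. sets \<pi> = sets borel \<and> distr \<pi> borel fst = M \<and> distr \<pi> borel snd = N}"

definition wasserstein1 :: "'a::euclidean_space measure \<Rightarrow> 'a measure \<Rightarrow> ennreal" where
  "wasserstein1 M N = (INF \<pi> \<in> couplings M N. \<integral>\<^sup>+ (x, y). ennreal (norm (x - y)) \<partial>\<pi>)"

definition gen_wasserstein ::
    "real \<Rightarrow> real \<Rightarrow> 'a::euclidean_space measure \<Rightarrow> 'a measure \<Rightarrow> ennreal" where
  "gen_wasserstein a b M N =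
     (INF (M', N') \<in> {(M', N'). M' \<in> finite_borel \<and> N' \<in> finite_borel \<and>
                        emeasure M' UNIV = emeasure N' UNIV}.
        ennreal a * (total_variation (sm_diff M M') + total_variation (sm_diff N N'))
        + ennreal b * wasserstein1 M' N')"

definition decompositions ::
    "'a::euclidean_space signed_measure \<Rightarrow> ('a measure \<times> 'a measure) set" where
  "decompositions \<mu> = {(M, N). M \<in> finite_borel \<and> N \<in> finite_borel \<and> \<mu> = sm_diff M N}"

definition gw_norm :: "real \<Rightarrow> real \<Rightarrow> 'a::euclidean_space signed_measure \<Rightarrow> real" where
  "gw_norm a b \<mu> =
     (case SOME p. p \<in> decompositions \<mu> of (M, N) \<Rightarrow> enn2real (gen_wasserstein a b M N))"

locale normed_vector_space = vector_space scale
  for scale :: "real \<Rightarrow> 'v::ab_group_add \<Rightarrow> 'v" +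
  fixes nrm :: "'v \<Rightarrow> real"
  assumes nrm_nonneg: "0 \<le> nrm x"
    and nrm_eq_zero_iff: "nrm x = 0 \<longleftrightarrow> x = 0"
    and nrm_scale: "nrm (scale r x) = \<bar>r\<bar> * nrm x"
    and nrm_triangle: "nrm (x + y) \<le> nrm x + nrm y"

end

theory Submission
  imports Defs
begin

text \<open>
  The generalized Wasserstein distance is an infimum over single transport plans whose marginals
  need not match the two measures. It is subadditive and homogeneous, and it satisfies the
  triangle inequality by an approximate gluing of plans over a partition into small cells.
  Passing from \<open>(n M, n N)\<close> to \<open>(n M + L, n N + L)\<close> and replacing one \<open>M\<close> at a time by \<open>N\<close>
  gives \<open>n d(M, N) \<le> n d(M + L, N + L) + 2 a |L|\<close>. Letting \<open>n\<close> tend to infinity shows that \<open>d\<close> is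
  translation invariant, so it depends only on \<open>M - N\<close>. If \<open>d(M, N) = 0\<close>, Markov's inequality
  bounds \<open>M C\<close> by the \<open>N\<close>-mass of every neighbourhood of a closed set \<open>C\<close>, hence \<open>M = N\<close>.
\<close>

section \<open>Finite Borel measures and total variation\<close>

text \<open>\<open>gw_norm\<close> is evaluated at an arbitrarily chosen decomposition, and two
  decompositions (M, N) and (M', N') of one signed measure satisfy M + N' = M' + N. Independence of
  the choice therefore amounts to translation invariance, and this is the hard point: a common part
  L might open cheap routes that are lost when L is removed. The remedy is that one copy of L serves
  all n exchanges, while the distance in question is multiplied by n. The triangle inequality of the
  distance serves only this purpose; the triangle inequality of the norm is subadditivity, obtained
  by adding plans. Minimizers are never formed. Near-optimal plans suffice, so no compactness
  enters, and merging the two nested infima leaves a single measure to manipulate.\<close>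

definition add_measure ::
    "'a::topological_space measure \<Rightarrow> 'a measure \<Rightarrow> 'a measure" where
  "add_measure M N = measure_of UNIV (sets borel) (\<lambda>A. emeasure M A + emeasure N A)"

lemma sets_add_measure [simp, measurable_cong]: "sets (add_measure M N) = sets borel"
  unfolding add_measure_def by (metis sets.sets_measure_of_eq space_borel)

lemma space_add_measure [simp]: "space (add_measure M N) = UNIV"
  by (metis sets_add_measure sets_eq_imp_space_eq space_borel)

lemma emeasure_add_measure:
  assumes "sets M = sets borel" "sets N = sets borel"
  shows "emeasure (add_measure M N) A = emeasure M A + emeasure N A"
proof (cases "A \<in> sets borel")
  case True
  show ?thesis
  proof (rule emeasure_measure_of[OF add_measure_def])
    show "countably_additive (sets (add_measure M N)) (\<lambda>A. emeasure M A + emeasure N A)"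
    proof (rule countably_additiveI)
      fix F :: "nat \<Rightarrow> 'a set"
      assume "range F \<subseteq> sets (add_measure M N)" "disjoint_family F"
      then show "(\<Sum>i. emeasure M (F i) + emeasure N (F i)) =
          emeasure M (\<Union>i. F i) + emeasure N (\<Union>i. F i)"
        using assms by (simp add: suminf_add[symmetric] suminf_emeasure)
    qed
  qed (use True in \<open>auto simp: positive_def\<close>)
next
  case False
  then show ?thesis by (simp add: emeasure_notin_sets assms)
qed

lemma add_measure_commute: "add_measure M N = add_measure N M"
  by (simp add: add_measure_def add.commute)

lemma add_measure_assoc:
  assumes "sets M = sets borel" "sets N = sets borel" "sets P = sets borel"
  shows "add_measure (add_measure M N) P = add_measure M (add_measure N P)"
  using assms by (intro measure_eqI) (simp_all add: emeasure_add_measure add.assoc)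

lemma scale_measure_inverse:
  assumes "0 < r"
  shows "scale_measure (ennreal (1 / r)) (scale_measure (ennreal r) M) = M"
  using assms by (intro measure_eqI) (simp_all flip: mult.assoc ennreal_mult)

lemma scale_measure_Suc:
  assumes "sets M = sets borel"
  shows "scale_measure (ennreal (real (Suc n))) M = add_measure M (scale_measure (ennreal (real n)) M)"
  using assms by (intro measure_eqI)
    (simp_all add: emeasure_add_measure distrib_right)

text \<open>Induction over the construction of f from indicators. In the limit step the supremum
  splits over the sum because both sequences of integrals increase.\<close>

lemma nn_integral_add_measure:
  assumes "sets M = sets borel" "sets N = sets borel" "f \<in> borel_measurable borel"
  shows "(\<integral>\<^sup>+x. f x \<partial>add_measure M N) = (\<integral>\<^sup>+x. f x \<partial>M) + (\<integral>\<^sup>+x. f x \<partial>N)"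
proof -
  have meas [measurable_cong]: "sets M = sets borel" "sets N = sets borel"
    using assms by auto
  from assms(3) show ?thesis
  proof (induction rule: borel_measurable_induct)
    case (cong f g)
    then show ?case by (simp add: fun_eq_iff)
  next
    case (set A)
    then show ?case using assms by (simp add: emeasure_add_measure)
  next
    case (mult u c)
    then have [measurable]: "u \<in> borel_measurable borel" by simp
    show ?case by (simp add: nn_integral_cmult mult.IH distrib_left)
  next
    case (add u v)
    then have [measurable]: "u \<in> borel_measurable borel" "v \<in> borel_measurable borel"
      by simp_all
    show ?case by (simp add: nn_integral_add add.IH algebra_simps)
  next
    case (seq U)
    then have [measurable]: "U i \<in> borel_measurable borel" for i by simp
    have mono: "incseq (\<lambda>i. \<integral>\<^sup>+x. U i x \<partial>L)" for L :: "'a measure"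
      using \<open>incseq U\<close> by (auto simp: incseq_def le_fun_def intro!: nn_integral_mono)
    have eq: "(\<integral>\<^sup>+x. (SUP i. U i) x \<partial>L) = (SUP i. \<integral>\<^sup>+x. U i x \<partial>L)"
      if [measurable_cong]: "sets L = sets borel" for L :: "'a measure"
      using nn_integral_monotone_convergence_SUP[OF \<open>incseq U\<close>, of L]
      by (simp add: image_comp)
    have "(SUP i. (\<integral>\<^sup>+x. U i x \<partial>M) + (\<integral>\<^sup>+x. U i x \<partial>N)) =
        (SUP i. \<integral>\<^sup>+x. U i x \<partial>M) + (SUP i. \<integral>\<^sup>+x. U i x \<partial>N)"
      by (intro ennreal_SUP_add mono)
    then show ?case
      by (simp only: eq meas sets_add_measure seq.IH)
  qed
qed

context
  fixes M :: "'a::euclidean_space measure"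
  assumes M: "M \<in> finite_borel"
begin

lemma finite_borel_sets [simp, measurable_cong]: "sets M = sets borel"
  using M by (simp add: finite_borel_def)

lemma finite_borel_space [simp]: "space M = UNIV"
  using finite_borel_sets sets_eq_imp_space_eq space_borel by blast

lemma finite_borel_finite_measure: "finite_measure M"
  using M by (simp add: finite_borel_def)

lemma finite_borel_finite [simp]: "emeasure M A \<noteq> \<infinity>" "emeasure M A \<noteq> top" "emeasure M A < top"
  using finite_measure.emeasure_finite[OF finite_borel_finite_measure]
  by (auto simp: less_top)

lemma finite_borel_emeasure: "emeasure M A = ennreal (measure M A)"
  using finite_measure.emeasure_eq_measure[OF finite_borel_finite_measure] .

end

lemma finite_borelI: "sets M = sets borel \<Longrightarrow> emeasure M UNIV \<noteq> top \<Longrightarrow> M \<in> finite_borel"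
  unfolding finite_borel_def using sets_eq_imp_space_eq[of M borel]
  by (auto intro!: finite_measureI)

lemma finite_borel_eqI:
  assumes "M \<in> finite_borel" "N \<in> finite_borel" "\<And>A. A \<in> sets borel \<Longrightarrow> measure M A = measure N A"
  shows "M = N"
  using assms by (intro measure_eqI) (auto simp: finite_borel_emeasure)

lemma add_measure_finite_borel:
  assumes "M \<in> finite_borel" "N \<in> finite_borel"
  shows "add_measure M N \<in> finite_borel"
  using assms by (intro finite_borelI) (simp_all add: emeasure_add_measure)

lemma measure_add_measure:
  assumes "M \<in> finite_borel" "N \<in> finite_borel"
  shows "measure (add_measure M N) A = measure M A + measure N A"
  using assms by (simp add: measure_def emeasure_add_measure enn2real_plus)

lemma scale_measure_finite_borel:
  "M \<in> finite_borel \<Longrightarrow> scale_measure (ennreal r) M \<in> finite_borel"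
  by (intro finite_borelI) (simp_all add: ennreal_mult_eq_top_iff)

lemma distr_finite_borel:
  assumes "M \<in> finite_borel" "f \<in> borel_measurable borel"
  shows "distr M borel f \<in> finite_borel"
proof (rule finite_borelI)
  have "f \<in> borel_measurable M"
    using assms by (simp add: measurable_cong_sets[OF finite_borel_sets refl])
  then show "emeasure (distr M borel f) UNIV \<noteq> top"
    using assms by (simp add: emeasure_distr)
qed simp

lemma distr_add_measure:
  assumes "sets M = sets borel" "sets N = sets borel" "f \<in> borel_measurable borel"
  shows "distr (add_measure M N) borel f = add_measure (distr M borel f) (distr N borel f)"
proof (rule measure_eqI)
  have [measurable_cong]: "sets M = sets borel" "sets N = sets borel" and [measurable]: "f \<in> borel_measurable borel"
    using assms by auto
  have "space M = UNIV" "space N = UNIV"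
    using assms sets_eq_imp_space_eq space_borel by blast+
  then show "emeasure (distr (add_measure M N) borel f) A =
      emeasure (add_measure (distr M borel f) (distr N borel f)) A"
    if "A \<in> sets (distr (add_measure M N) borel f)" for A
    using that assms by (simp add: emeasure_add_measure emeasure_distr)
qed simp

lemma distr_scale_measure:
  assumes "sets M = sets borel" "f \<in> borel_measurable borel"
  shows "distr (scale_measure r M) borel f = scale_measure r (distr M borel f)"
proof (rule measure_eqI)
  have [measurable_cong]: "sets M = sets borel" and [measurable]: "f \<in> borel_measurable borel"
    using assms by auto
  show "emeasure (distr (scale_measure r M) borel f) A =
      emeasure (scale_measure r (distr M borel f)) A"
    if "A \<in> sets (distr (scale_measure r M) borel f)" for A
    using that by (simp add: emeasure_distr space_scale_measure)
qed simp

section \<open>Algebra of differences of finite measures\<close>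

lemma sm_diff_add_measure:
  assumes "M \<in> finite_borel" "N \<in> finite_borel" "M' \<in> finite_borel" "N' \<in> finite_borel"
  shows "sm_diff (add_measure M M') (add_measure N N') = sm_diff M N + sm_diff M' N'"
  using assms
  by (intro sm_eqI)
    (simp add: sm_apply_plus sm_apply_sm_diff measure_add_measure add_measure_finite_borel)

lemma sm_diff_scale_measure:
  assumes "M \<in> finite_borel" "N \<in> finite_borel" "0 \<le> r"
  shows "sm_diff (scale_measure (ennreal r) M) (scale_measure (ennreal r) N) = r *\<^sub>R sm_diff M N"
  using assms
  by (intro sm_eqI) (simp add: sm_apply_scaleR sm_apply_sm_diff scale_measure_finite_borel
      right_diff_distrib)

lemma uminus_sm_diff:
  assumes "M \<in> finite_borel" "N \<in> finite_borel"
  shows "- sm_diff M N = sm_diff N M"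
  using assms by (intro sm_eqI) (simp add: sm_apply_uminus sm_apply_sm_diff)

lemma sm_diff_trans:
  assumes "M \<in> finite_borel" "N \<in> finite_borel" "P \<in> finite_borel"
  shows "sm_diff M P = sm_diff M N + sm_diff N P"
  using assms by (intro sm_eqI) (simp add: sm_apply_plus sm_apply_sm_diff)

lemma sm_diff_self: "M \<in> finite_borel \<Longrightarrow> sm_diff M M = 0"
  by (intro sm_eqI) (simp add: sm_apply_zero sm_apply_sm_diff)

text \<open>Moving the negative parts across turns an equality of signed measures into one of
  positive measures. In this form translation invariance yields independence of the
  decomposition.\<close>

lemma sm_diff_eq_iff:
  assumes "M \<in> finite_borel" "N \<in> finite_borel" "M' \<in> finite_borel" "N' \<in> finite_borel"
  shows "sm_diff M N = sm_diff M' N' \<longleftrightarrow> add_measure M N' = add_measure M' N"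
proof
  assume "sm_diff M N = sm_diff M' N'"
  then have "measure M A - measure N A = measure M' A - measure N' A" for A
    using assms by (metis sm_apply_sm_diff)
  then show "add_measure M N' = add_measure M' N"
    using assms by (intro finite_borel_eqI)
      (auto simp: measure_add_measure add_measure_finite_borel algebra_simps)
next
  assume "add_measure M N' = add_measure M' N"
  then have "measure M A + measure N' A = measure M' A + measure N A" for A
    using assms by (metis measure_add_measure)
  then show "sm_diff M N = sm_diff M' N'"
    using assms by (intro sm_eqI) (simp add: sm_apply_sm_diff algebra_simps)
qed

section \<open>Total variation: norm properties and comparison with mass\<close>

lemma total_variation_upper:
  assumes "\<And>i. A i \<in> sets borel" "disjoint_family A" "(\<Union>i. A i) = UNIV"
  shows "(\<Sum>i. ennreal \<bar>sm_apply \<mu> (A i)\<bar>) \<le> total_variation \<mu>"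
  unfolding total_variation_def using assms by (intro SUP_upper) auto

lemma total_variation_least:
  assumes "\<And>A. (\<And>i. A i \<in> sets borel) \<Longrightarrow> disjoint_family A \<Longrightarrow> (\<Union>i. A i) = UNIV \<Longrightarrow>
    (\<Sum>i. ennreal \<bar>sm_apply \<mu> (A i)\<bar>) \<le> c"
  shows "total_variation \<mu> \<le> c"
  unfolding total_variation_def using assms by (intro SUP_least) auto

lemma total_variation_zero [simp]: "total_variation (0 :: 'a::euclidean_space signed_measure) = 0"
  using total_variation_least[of "0 :: 'a signed_measure" 0] by (simp add: sm_apply_zero)

lemma total_variation_add:
  "total_variation (\<mu> + \<nu>) \<le> total_variation \<mu> + total_variation \<nu>"
proof (rule total_variation_least)
  fix A :: "nat \<Rightarrow> 'a set"
  assume A: "\<And>i. A i \<in> sets borel" "disjoint_family A" "(\<Union>i. A i) = UNIV"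
  have "(\<Sum>i. ennreal \<bar>sm_apply (\<mu> + \<nu>) (A i)\<bar>) \<le>
      (\<Sum>i. ennreal \<bar>sm_apply \<mu> (A i)\<bar> + ennreal \<bar>sm_apply \<nu> (A i)\<bar>)"
    by (intro suminf_le) (auto simp: sm_apply_plus simp flip: ennreal_plus intro!: ennreal_leI)
  also have "\<dots> = (\<Sum>i. ennreal \<bar>sm_apply \<mu> (A i)\<bar>) + (\<Sum>i. ennreal \<bar>sm_apply \<nu> (A i)\<bar>)"
    by (simp add: suminf_add)
  also have "\<dots> \<le> total_variation \<mu> + total_variation \<nu>"
    using A by (intro add_mono total_variation_upper)
  finally show "(\<Sum>i. ennreal \<bar>sm_apply (\<mu> + \<nu>) (A i)\<bar>) \<le> total_variation \<mu> + total_variation \<nu>" .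
qed

lemma total_variation_scaleR_le:
  "total_variation (r *\<^sub>R \<mu>) \<le> ennreal \<bar>r\<bar> * total_variation \<mu>"
proof (rule total_variation_least)
  fix A :: "nat \<Rightarrow> 'a set"
  assume A: "\<And>i. A i \<in> sets borel" "disjoint_family A" "(\<Union>i. A i) = UNIV"
  have "(\<Sum>i. ennreal \<bar>sm_apply (r *\<^sub>R \<mu>) (A i)\<bar>) = ennreal \<bar>r\<bar> * (\<Sum>i. ennreal \<bar>sm_apply \<mu> (A i)\<bar>)"
    by (simp add: sm_apply_scaleR abs_mult ennreal_mult)
  also have "\<dots> \<le> ennreal \<bar>r\<bar> * total_variation \<mu>"
    using A by (intro mult_left_mono total_variation_upper) auto
  finally show "(\<Sum>i. ennreal \<bar>sm_apply (r *\<^sub>R \<mu>) (A i)\<bar>) \<le> ennreal \<bar>r\<bar> * total_variation \<mu>" .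
qed

text \<open>The scaling bound with factor -1, applied to \<mu> and to - \<mu>, gives the two
  inequalities.\<close>

lemma total_variation_uminus [simp]: "total_variation (- \<mu>) = total_variation \<mu>"
  using total_variation_scaleR_le[of "-1" \<mu>] total_variation_scaleR_le[of "-1" "- \<mu>"]
  by (simp add: order_antisym)

lemma total_variation_sm_diff_commute:
  assumes "M \<in> finite_borel" "N \<in> finite_borel"
  shows "total_variation (sm_diff M N) = total_variation (sm_diff N M)"
  using assms by (metis total_variation_uminus uminus_sm_diff)

lemma total_variation_sm_diff_triangle:
  assumes "M \<in> finite_borel" "N \<in> finite_borel" "P \<in> finite_borel"
  shows "total_variation (sm_diff M P) \<le> total_variation (sm_diff M N) + total_variation (sm_diff N P)"
  using assms by (metis sm_diff_trans total_variation_add)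

lemma total_variation_sm_diff_dominated:
  assumes M: "M \<in> finite_borel" and N: "N \<in> finite_borel"
    and le: "\<And>A. A \<in> sets borel \<Longrightarrow> emeasure N A \<le> emeasure M A"
  shows "total_variation (sm_diff M N) + emeasure N UNIV \<le> emeasure M UNIV"
proof -
  have "total_variation (sm_diff M N) \<le> emeasure M UNIV - emeasure N UNIV"
  proof (rule total_variation_least)
    fix A :: "nat \<Rightarrow> 'a set"
    assume A: "\<And>i. A i \<in> sets borel" "disjoint_family A" "(\<Union>i. A i) = UNIV"
    have U: "emeasure L UNIV = (\<Sum>i. emeasure L (A i))" if "L \<in> finite_borel" for L
      using A suminf_emeasure[of A L] that by (simp add: image_subset_iff)
    have "ennreal \<bar>sm_apply (sm_diff M N) (A i)\<bar> + emeasure N (A i) = emeasure M (A i)" for i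
      using le[OF A(1), of i] M N
      by (simp add: sm_apply_sm_diff finite_borel_emeasure flip: ennreal_plus)
    then have "(\<Sum>i. ennreal \<bar>sm_apply (sm_diff M N) (A i)\<bar>) + emeasure N UNIV = emeasure M UNIV"
      using U[OF M] U[OF N] by (simp add: suminf_add)
    then show "(\<Sum>i. ennreal \<bar>sm_apply (sm_diff M N) (A i)\<bar>) \<le> emeasure M UNIV - emeasure N UNIV"
      using N by (metis ennreal_add_diff_cancel_right finite_borel_finite(2) order_refl)
  qed
  then show ?thesis
    using le[of UNIV] by (metis add.commute add_left_mono add_diff_inverse_ennreal borel_open open_UNIV)
qed

lemma total_variation_sm_diff_add_measure:
  assumes "M \<in> finite_borel" "L \<in> finite_borel"
  shows "total_variation (sm_diff M (add_measure M L)) \<le> emeasure L UNIV"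
proof -
  have "total_variation (sm_diff (add_measure M L) M) + emeasure M UNIV \<le> emeasure (add_measure M L) UNIV"
    using assms
    by (intro total_variation_sm_diff_dominated) (simp_all add: add_measure_finite_borel emeasure_add_measure)
  then have "emeasure M UNIV + total_variation (sm_diff M (add_measure M L)) \<le> emeasure M UNIV + emeasure L UNIV"
    using assms
    by (simp add: emeasure_add_measure add_measure_finite_borel add.commute
        total_variation_sm_diff_commute[of M])
  then show ?thesis using assms by (simp add: ennreal_add_left_cancel_le)
qed

lemma emeasure_le_total_variation:
  assumes "M \<in> finite_borel" "N \<in> finite_borel" "A \<in> sets borel"
  shows "emeasure M A \<le> emeasure N A + total_variation (sm_diff M N)"
proof -
  have "emeasure M A \<le> emeasure N A + ennreal \<bar>sm_apply (sm_diff M N) A\<bar>"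
    using assms by (simp add: finite_borel_emeasure sm_apply_sm_diff flip: ennreal_plus)
  also have "ennreal \<bar>sm_apply (sm_diff M N) A\<bar> \<le> total_variation (sm_diff M N)"
  proof -
    \<comment> \<open>The sequence A, - A, {}, {}, ... is a partition of the space whose first term
      alone gives the bound.\<close>
    let ?B = "binaryset A (- A)"
    have "(\<Sum>i<1. ennreal \<bar>sm_apply (sm_diff M N) (?B i)\<bar>) \<le> (\<Sum>i. ennreal \<bar>sm_apply (sm_diff M N) (?B i)\<bar>)"
      by (intro sum_le_suminf) auto
    also have "\<dots> \<le> total_variation (sm_diff M N)"
      using assms(3)
      by (intro total_variation_upper)
        (auto simp: binaryset_def disjoint_family_on_def UN_binaryset_eq)
    finally show ?thesis by (simp add: binaryset_def)
  qed
  finally show ?thesis by simp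
qed

section \<open>Transport plans\<close>

lemma borel_measurable_fst_snd [simp]:
  fixes M :: "('a::topological_space \<times> 'b::topological_space) measure"
  assumes "sets M = sets borel"
  shows "fst \<in> borel_measurable M" "snd \<in> borel_measurable M"
  unfolding measurable_cong_sets[OF assms refl]
  by (intro borel_measurable_continuous_onI continuous_intros)+

lemma borel_measurable_norm_fst_snd [simp]:
  fixes M :: "('a::euclidean_space \<times> 'a) measure"
  assumes "sets M = sets borel"
  shows "(\<lambda>z. norm (fst z - snd z)) \<in> borel_measurable M"
  using borel_measurable_fst_snd[OF assms] by measurable

definition transport_cost :: "('a::euclidean_space \<times> 'a) measure \<Rightarrow> ennreal" where
  "transport_cost \<pi> = (\<integral>\<^sup>+ z. ennreal (norm (fst z - snd z)) \<partial>\<pi>)"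

definition marg1 :: "('a::euclidean_space \<times> 'a) measure \<Rightarrow> 'a measure" where
  "marg1 \<pi> = distr \<pi> borel fst"

definition marg2 :: "('a::euclidean_space \<times> 'a) measure \<Rightarrow> 'a measure" where
  "marg2 \<pi> = distr \<pi> borel snd"

text \<open>The measures M' and N' are recovered as the marginals of the plan. They have equal mass
  automatically, since both carry the mass of \<pi>.\<close>

definition plan_cost ::
    "real \<Rightarrow> real \<Rightarrow> 'a::euclidean_space measure \<Rightarrow> 'a measure \<Rightarrow> ('a \<times> 'a) measure \<Rightarrow> ennreal" where
  "plan_cost a b M N \<pi> =
     ennreal a * (total_variation (sm_diff M (marg1 \<pi>)) + total_variation (sm_diff N (marg2 \<pi>)))
     + ennreal b * transport_cost \<pi>"

lemma marg_finite_borel [simp]: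
  assumes "\<pi> \<in> finite_borel"
  shows "marg1 \<pi> \<in> finite_borel" "marg2 \<pi> \<in> finite_borel"
  unfolding marg1_def marg2_def using assms by (auto intro!: distr_finite_borel)

lemma emeasure_marg:
  assumes "\<pi> \<in> finite_borel" "A \<in> sets borel"
  shows "emeasure (marg1 \<pi>) A = emeasure \<pi> (fst -` A)" "emeasure (marg2 \<pi>) A = emeasure \<pi> (snd -` A)"
  using assms by (simp_all add: marg1_def marg2_def emeasure_distr)

lemma gen_wasserstein_le_plan_cost:
  assumes "\<pi> \<in> finite_borel"
  shows "gen_wasserstein a b M N \<le> plan_cost a b M N \<pi>"
proof -
  have "(marg1 \<pi>, marg2 \<pi>) \<in> {(M', N'). M' \<in> finite_borel \<and> N' \<in> finite_borel \<and>
      emeasure M' UNIV = emeasure N' UNIV}"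
    using assms by (simp add: emeasure_marg)
  moreover have "wasserstein1 (marg1 \<pi>) (marg2 \<pi>) \<le> transport_cost \<pi>"
    unfolding wasserstein1_def transport_cost_def
    by (rule INF_lower2[of \<pi>])
      (use assms in \<open>simp_all add: couplings_def marg1_def marg2_def case_prod_unfold\<close>)
  ultimately show ?thesis
    unfolding gen_wasserstein_def plan_cost_def
    by (intro INF_lower2[of "(marg1 \<pi>, marg2 \<pi>)"]) (auto intro!: add_mono mult_left_mono)
qed

text \<open>\<open>couplings\<close> does not ask for finite mass; it is inherited from M, because a
  pushforward preserves total mass.\<close>

lemma couplings_finite_borel:
  assumes "M \<in> finite_borel" "\<pi> \<in> couplings M N"
  shows "\<pi> \<in> finite_borel"
proof (rule finite_borelI)
  show [measurable_cong]: "sets \<pi> = sets borel" using assms by (simp add: couplings_def)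
  have "space \<pi> = UNIV" using \<open>sets \<pi> = sets borel\<close> sets_eq_imp_space_eq space_borel by blast
  then have "emeasure M UNIV = emeasure \<pi> UNIV"
    using assms by (auto simp: couplings_def emeasure_distr)
  then show "emeasure \<pi> UNIV \<noteq> top" using assms by (metis finite_borel_finite(2))
qed

text \<open>The inner infimum over couplings has to be pulled through t + b * _. For finite t this
  is done by moving t and the positive factor b to the other side, bounding below every coupling,
  and moving them back; for infinite t the claim is trivial.\<close>

lemma gen_wasserstein_eq_INF:
  assumes "0 < b"
  shows "gen_wasserstein a b M N = (INF \<pi>\<in>finite_borel. plan_cost a b M N \<pi>)"
proof (rule antisym)
  show "gen_wasserstein a b M N \<le> (INF \<pi>\<in>finite_borel. plan_cost a b M N \<pi>)"
    by (intro INF_greatest gen_wasserstein_le_plan_cost)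
  let ?c = "INF \<pi>\<in>finite_borel. plan_cost a b M N \<pi>"
  show "?c \<le> gen_wasserstein a b M N"
    unfolding gen_wasserstein_def
  proof (rule INF_greatest, clarify)
    fix M' N' :: "'a measure"
    assume fin: "M' \<in> finite_borel" "N' \<in> finite_borel"
    define t where "t = ennreal a * (total_variation (sm_diff M M') + total_variation (sm_diff N N'))"
    show "?c \<le> t + ennreal b * wasserstein1 M' N'"
    proof (cases "t = top")
      case False
      have "ennreal (1 / b) * (?c - t) \<le> wasserstein1 M' N'"
        unfolding wasserstein1_def
      proof (rule INF_greatest)
        fix \<pi> assume \<pi>: "\<pi> \<in> couplings M' N'"
        have "?c \<le> plan_cost a b M N \<pi>"
          using couplings_finite_borel[OF fin(1) \<pi>] by (intro INF_lower)
        also have "\<dots> = t + ennreal b * transport_cost \<pi>"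
          using \<pi> by (simp add: plan_cost_def t_def couplings_def marg1_def marg2_def)
        finally have "?c - t \<le> ennreal b * transport_cost \<pi>"
          using False by (simp add: ennreal_minus_le_iff)
        then have "ennreal (1 / b) * (?c - t) \<le> ennreal (1 / b) * (ennreal b * transport_cost \<pi>)"
          by (intro mult_left_mono) auto
        also have "\<dots> = transport_cost \<pi>"
          using assms by (simp flip: mult.assoc ennreal_mult)
        finally show "ennreal (1 / b) * (?c - t) \<le> (\<integral>\<^sup>+ (x, y). ennreal (norm (x - y)) \<partial>\<pi>)"
          by (simp add: transport_cost_def case_prod_unfold)
      qed
      then have "ennreal b * (ennreal (1 / b) * (?c - t)) \<le> ennreal b * wasserstein1 M' N'"
        by (intro mult_left_mono) auto
      then have "?c - t \<le> ennreal b * wasserstein1 M' N'"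
        using assms by (simp flip: mult.assoc ennreal_mult)
      then show ?thesis
        by (simp add: ennreal_minus_le_iff)
    qed simp
  qed
qed

lemma gen_wasserstein_approx_plan:
  assumes "0 < b" "gen_wasserstein a b M N < c"
  obtains \<pi> where "\<pi> \<in> finite_borel" "plan_cost a b M N \<pi> < c"
  using assms by (auto simp: gen_wasserstein_eq_INF INF_less_iff)

lemma total_variation_sm_diff_null:
  assumes "M \<in> finite_borel"
  shows "total_variation (sm_diff M (null_measure borel)) \<le> emeasure M UNIV"
  using total_variation_sm_diff_dominated[OF assms null_measure_finite_borel] by simp

text \<open>The null plan moves nothing and discards all mass, at cost at most a(|M| + |N|). Hence
  the distance is finite even between measures without first moments, where
  \<open>wasserstein1\<close> may be infinite.\<close>

lemma gen_wasserstein_finite: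
  assumes "M \<in> finite_borel" "N \<in> finite_borel"
  shows "gen_wasserstein a b M N < top"
proof -
  let ?z = "null_measure (borel :: ('a \<times> 'a) measure)"
  have m: "marg1 ?z = null_measure borel" "marg2 ?z = null_measure borel"
    by (auto intro!: measure_eqI simp: marg1_def marg2_def emeasure_distr)
  have "transport_cost ?z = 0"
    by (simp add: transport_cost_def)
  then have "plan_cost a b M N ?z \<le> ennreal a * (emeasure M UNIV + emeasure N UNIV)"
    unfolding plan_cost_def m using assms
    by (auto intro!: mult_left_mono add_mono total_variation_sm_diff_null)
  also have "\<dots> < top"
    using assms by (simp add: ennreal_mult_less_top)
  finally show ?thesis
    using gen_wasserstein_le_plan_cost[OF null_measure_finite_borel] by (metis order_le_less_trans)
qed

section \<open>Symmetry, subadditivity, homogeneity and the diagonal bound\<close>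

lemma gen_wasserstein_commute_le:
  assumes "0 < b"
  shows "gen_wasserstein a b N M \<le> gen_wasserstein a b M N"
  unfolding gen_wasserstein_eq_INF[OF assms, of a M N]
proof (rule INF_greatest)
  fix \<pi> :: "('a \<times> 'a) measure" assume \<pi>: "\<pi> \<in> finite_borel"
  note [measurable_cong] = finite_borel_sets[OF \<pi>]
  have swap: "prod.swap \<in> borel_measurable (borel :: ('a \<times> 'a) measure)"
    unfolding prod.swap_def by (intro borel_measurable_continuous_onI continuous_intros)
  then have swap': "prod.swap \<in> borel_measurable \<pi>"
    using \<pi> by (simp add: measurable_cong_sets[OF finite_borel_sets refl])
  define \<rho> where "\<rho> = distr \<pi> borel prod.swap"
  have "\<rho> \<in> finite_borel" unfolding \<rho>_def by (intro distr_finite_borel \<pi> swap)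
  moreover have "marg1 \<rho> = marg2 \<pi>" "marg2 \<rho> = marg1 \<pi>"
    using \<pi> swap'
    by (simp_all add: marg1_def marg2_def \<rho>_def distr_distr comp_def)
  moreover have "transport_cost \<rho> = transport_cost \<pi>"
    using swap'
    by (simp add: transport_cost_def \<rho>_def nn_integral_distr norm_minus_commute)
  ultimately show "gen_wasserstein a b N M \<le> plan_cost a b M N \<pi>"
    using gen_wasserstein_le_plan_cost[of \<rho> a b N M] by (simp add: plan_cost_def add.commute)
qed

lemma gen_wasserstein_commute:
  "0 < b \<Longrightarrow> gen_wasserstein a b N M = gen_wasserstein a b M N"
  by (intro antisym gen_wasserstein_commute_le)

text \<open>The sum of two plans has the sums of the marginals as marginals and the sum of the
  transport costs as cost. This is what becomes the triangle inequality of the norm.\<close>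

lemma gen_wasserstein_add_le:
  assumes b: "0 < b"
    and fin: "M \<in> finite_borel" "N \<in> finite_borel" "M' \<in> finite_borel" "N' \<in> finite_borel"
  shows "gen_wasserstein a b (add_measure M M') (add_measure N N') \<le>
    gen_wasserstein a b M N + gen_wasserstein a b M' N'"
proof (rule ennreal_le_epsilon)
  fix e :: real assume "0 < e" and "gen_wasserstein a b M N + gen_wasserstein a b M' N' < top"
  then have "gen_wasserstein a b M N < gen_wasserstein a b M N + ennreal (e / 2)"
    "gen_wasserstein a b M' N' < gen_wasserstein a b M' N' + ennreal (e / 2)"
    by (auto simp: less_top)
  then obtain \<pi> \<rho> where
    \<pi>: "\<pi> \<in> finite_borel" "plan_cost a b M N \<pi> < gen_wasserstein a b M N + ennreal (e / 2)" and
    \<rho>: "\<rho> \<in> finite_borel" "plan_cost a b M' N' \<rho> < gen_wasserstein a b M' N' + ennreal (e / 2)"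
    by (metis b gen_wasserstein_approx_plan)
  let ?\<gamma> = "add_measure \<pi> \<rho>"
  have m: "marg1 ?\<gamma> = add_measure (marg1 \<pi>) (marg1 \<rho>)" "marg2 ?\<gamma> = add_measure (marg2 \<pi>) (marg2 \<rho>)"
    unfolding marg1_def marg2_def using \<pi> \<rho> by (auto intro!: distr_add_measure)
  have "transport_cost ?\<gamma> = transport_cost \<pi> + transport_cost \<rho>"
    unfolding transport_cost_def using \<pi> \<rho> by (intro nn_integral_add_measure) auto
  moreover have "total_variation (sm_diff (add_measure M M') (marg1 ?\<gamma>)) \<le>
      total_variation (sm_diff M (marg1 \<pi>)) + total_variation (sm_diff M' (marg1 \<rho>))"
    unfolding m using \<pi> \<rho> fin by (simp add: sm_diff_add_measure total_variation_add)
  moreover have "total_variation (sm_diff (add_measure N N') (marg2 ?\<gamma>)) \<le>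
      total_variation (sm_diff N (marg2 \<pi>)) + total_variation (sm_diff N' (marg2 \<rho>))"
    unfolding m using \<pi> \<rho> fin by (simp add: sm_diff_add_measure total_variation_add)
  ultimately have "plan_cost a b (add_measure M M') (add_measure N N') ?\<gamma> \<le>
      ennreal a * ((total_variation (sm_diff M (marg1 \<pi>)) + total_variation (sm_diff M' (marg1 \<rho>)))
        + (total_variation (sm_diff N (marg2 \<pi>)) + total_variation (sm_diff N' (marg2 \<rho>))))
      + ennreal b * (transport_cost \<pi> + transport_cost \<rho>)"
    unfolding plan_cost_def by (auto intro!: add_mono mult_left_mono)
  also have "\<dots> = plan_cost a b M N \<pi> + plan_cost a b M' N' \<rho>"
    by (simp add: plan_cost_def distrib_left ac_simps)
  also have "\<dots> \<le> (gen_wasserstein a b M N + ennreal (e / 2)) + (gen_wasserstein a b M' N' + ennreal (e / 2))"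
    using \<pi> \<rho> by (intro add_mono) auto
  also have "\<dots> = (gen_wasserstein a b M N + gen_wasserstein a b M' N') + (ennreal (e / 2) + ennreal (e / 2))"
    by (simp add: ac_simps)
  also have "ennreal (e / 2) + ennreal (e / 2) = ennreal e"
    using \<open>0 < e\<close> by (simp flip: ennreal_plus)
  finally show "gen_wasserstein a b (add_measure M M') (add_measure N N') \<le>
      gen_wasserstein a b M N + gen_wasserstein a b M' N' + ennreal e"
    using gen_wasserstein_le_plan_cost[OF add_measure_finite_borel[OF \<pi>(1) \<rho>(1)]] by (metis order_trans)
qed

lemma gen_wasserstein_scale_le:
  assumes b: "0 < b" and r: "0 \<le> r" and fin: "M \<in> finite_borel" "N \<in> finite_borel"
  shows "gen_wasserstein a b (scale_measure (ennreal r) M) (scale_measure (ennreal r) N) \<le>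
    ennreal r * gen_wasserstein a b M N"
proof (rule ennreal_le_epsilon)
  let ?R = "scale_measure (ennreal r)"
  fix e :: real assume e: "0 < e"
  \<comment> \<open>Scaling multiplies the error by r, and r * d \<le> e; the summand 1 keeps the
    denominator positive for r = 0.\<close>
  define d where "d = e / (r + 1)"
  have "0 < d" using e r by (simp add: d_def)
  then have "gen_wasserstein a b M N < gen_wasserstein a b M N + ennreal d"
    using gen_wasserstein_finite[OF fin, of a b] by (auto simp: less_top)
  then obtain \<pi> where \<pi>: "\<pi> \<in> finite_borel" "plan_cost a b M N \<pi> < gen_wasserstein a b M N + ennreal d"
    by (metis b gen_wasserstein_approx_plan)
  note [measurable_cong] = finite_borel_sets[OF \<pi>(1)]
  let ?\<gamma> = "scale_measure (ennreal r) \<pi>"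
  have m: "marg1 ?\<gamma> = ?R (marg1 \<pi>)" "marg2 ?\<gamma> = ?R (marg2 \<pi>)"
    unfolding marg1_def marg2_def using \<pi> by (auto intro!: distr_scale_measure)
  have "transport_cost ?\<gamma> = ennreal r * transport_cost \<pi>"
    unfolding transport_cost_def using \<pi> by (intro nn_integral_scale_measure) simp
  moreover have "total_variation (sm_diff (?R M) (marg1 ?\<gamma>)) \<le> ennreal r * total_variation (sm_diff M (marg1 \<pi>))"
    "total_variation (sm_diff (?R N) (marg2 ?\<gamma>)) \<le> ennreal r * total_variation (sm_diff N (marg2 \<pi>))"
    unfolding m using \<pi> fin r total_variation_scaleR_le[of r] by (simp_all add: sm_diff_scale_measure)
  ultimately have "plan_cost a b (?R M) (?R N) ?\<gamma> \<le>
      ennreal a * (ennreal r * total_variation (sm_diff M (marg1 \<pi>)) + ennreal r * total_variation (sm_diff N (marg2 \<pi>)))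
      + ennreal b * (ennreal r * transport_cost \<pi>)"
    unfolding plan_cost_def by (auto intro!: add_mono mult_left_mono)
  also have "\<dots> = ennreal r * plan_cost a b M N \<pi>"
    by (simp add: plan_cost_def distrib_left ac_simps)
  also have "\<dots> \<le> ennreal r * (gen_wasserstein a b M N + ennreal d)"
    using \<pi> by (intro mult_left_mono) auto
  also have "\<dots> \<le> ennreal r * gen_wasserstein a b M N + ennreal e"
    using e r by (auto simp: distrib_left d_def field_simps simp flip: ennreal_mult intro!: add_mono ennreal_leI)
  finally show "gen_wasserstein a b (?R M) (?R N) \<le> ennreal r * gen_wasserstein a b M N + ennreal e"
    using gen_wasserstein_le_plan_cost[OF scale_measure_finite_borel[OF \<pi>(1)]] by (metis order_trans)
qed

text \<open>The image of N on the diagonal leaves all of N in place at no transport cost, so only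
  the discrepancy between M and N is paid.\<close>

lemma gen_wasserstein_diagonal:
  assumes "M \<in> finite_borel" "N \<in> finite_borel"
  shows "gen_wasserstein a b M N \<le> ennreal a * total_variation (sm_diff M N)"
proof -
  have d: "(\<lambda>x. (x, x)) \<in> borel_measurable (borel :: 'a measure)"
    by (intro borel_measurable_continuous_onI continuous_intros)
  have [measurable]: "(\<lambda>x. (x, x)) \<in> borel_measurable N"
    using assms d by (simp add: measurable_cong_sets[OF finite_borel_sets refl])
  define \<pi> where "\<pi> = distr N borel (\<lambda>x. (x, x))"
  have "\<pi> \<in> finite_borel" unfolding \<pi>_def using assms d by (intro distr_finite_borel)
  moreover have "marg1 \<pi> = N" "marg2 \<pi> = N"
    using assms by (simp_all add: \<pi>_def marg1_def marg2_def distr_distr comp_def distr_id2)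
  moreover have "transport_cost \<pi> = 0"
    by (simp add: transport_cost_def \<pi>_def nn_integral_distr)
  ultimately show ?thesis
    using gen_wasserstein_le_plan_cost[of \<pi> a b M N] assms by (simp add: plan_cost_def sm_diff_self)
qed

section \<open>Gluing of plans\<close>

text \<open>A point is labelled by the first member of a dense sequence within e / 2 of it; two
  points with the same label are close to the same member. The label is an integer, so later
  measurability arguments can split over its values.\<close>

lemma ex_countable_cells:
  fixes e :: real
  assumes "0 < e"
  obtains h :: "'a::euclidean_space \<Rightarrow> nat"
  where "h \<in> measurable borel (count_space UNIV)" "\<And>x y. h x = h y \<Longrightarrow> dist x y < e"
proof -
  obtain D :: "'a set" where D: "countable D" "\<And>X. open X \<Longrightarrow> X \<noteq> {} \<Longrightarrow> \<exists>d\<in>D. d \<in> X"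
    by (erule countable_dense_setE)
  then have "D \<noteq> {}" by blast
  define c where "c = from_nat_into D"
  define h where "h x = (LEAST i. dist x (c i) < e / 2)" for x
  have near: "dist x (c (h x)) < e / 2" for x
  proof -
    obtain d where "d \<in> D" "d \<in> ball x (e / 2)"
      using D(2)[of "ball x (e / 2)"] assms by auto
    moreover obtain i where "c i = d"
      using from_nat_into_surj[OF D(1) \<open>d \<in> D\<close>] by (auto simp: c_def)
    ultimately show ?thesis
      unfolding h_def by (intro LeastI[where P = "\<lambda>i. dist x (c i) < e / 2" and k = i]) (simp add: ball_def)
  qed
  show ?thesis
  proof (rule that)
    show "h \<in> measurable borel (count_space UNIV)"
      unfolding h_def by measurable
    show "dist x y < e" if "h x = h y" for x y
      using near[of x] near[of y] that by (metis dist_triangle_half_l)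
  qed
qed

lemma emeasure_marg_nn_integral:
  assumes "\<pi> \<in> finite_borel" "C \<in> sets borel"
  shows "emeasure (marg1 \<pi>) C = (\<integral>\<^sup>+z. indicator C (fst z) \<partial>\<pi>)"
    "emeasure (marg2 \<pi>) C = (\<integral>\<^sup>+z. indicator C (snd z) \<partial>\<pi>)"
  using assms by (simp_all add: marg1_def marg2_def nn_integral_distr flip: nn_integral_indicator)

text \<open>
  Approximate gluing without disintegration: \<open>\<pi>\<close> and \<open>\<rho>\<close> are composed by moving mass
  independently inside each cell of a countable partition. Dividing by the larger of the two
  cell masses also discards the excess mass when the middle marginals differ.
\<close>

lemma glue_plans:
  fixes \<pi> \<rho> :: "('a::euclidean_space \<times> 'a) measure" and e :: real
  assumes \<pi>: "\<pi> \<in> finite_borel" and \<rho>: "\<rho> \<in> finite_borel" and e: "0 < e"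
  obtains \<gamma> where "\<gamma> \<in> finite_borel"
    "total_variation (sm_diff (marg1 \<pi>) (marg1 \<gamma>)) + total_variation (sm_diff (marg2 \<rho>) (marg2 \<gamma>))
       \<le> total_variation (sm_diff (marg2 \<pi>) (marg1 \<rho>))"
    "transport_cost \<gamma> \<le> transport_cost \<pi> + transport_cost \<rho> + ennreal e * emeasure \<pi> UNIV"
proof -
  obtain h :: "'a \<Rightarrow> nat" where h: "h \<in> measurable borel (count_space UNIV)"
    and cell: "\<And>x y. h x = h y \<Longrightarrow> dist x y < e"
    using ex_countable_cells[OF e, where ?'a = 'a] by blast
  interpret p: finite_measure \<pi> using \<pi> by (rule finite_borel_finite_measure)
  interpret r: finite_measure \<rho> using \<rho> by (rule finite_borel_finite_measure)
  interpret pr: pair_sigma_finite \<pi> \<rho> ..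
  have sets: "sets \<pi> = sets borel" "sets \<rho> = sets borel" using \<pi> \<rho> by simp_all
  have fs [measurable]: "fst \<in> borel_measurable \<pi>" "snd \<in> borel_measurable \<pi>"
    "fst \<in> borel_measurable \<rho>" "snd \<in> borel_measurable \<rho>"
    using sets by simp_all
  have hp [measurable]: "(\<lambda>u. h (snd u)) \<in> measurable \<pi> (count_space UNIV)"
    by (rule measurable_compose[OF fs(2) h])
  have hr [measurable]: "(\<lambda>v. h (fst v)) \<in> measurable \<rho> (count_space UNIV)"
    by (rule measurable_compose[OF fs(3) h])
  define A :: "nat \<Rightarrow> ('a \<times> 'a) set" where "A n = {u. h (snd u) = n}" for n
  define B :: "nat \<Rightarrow> ('a \<times> 'a) set" where "B n = {v. h (fst v) = n}" for n
  have A: "A n \<in> sets \<pi>" for n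
    using measurable_sets[OF hp, of "{n}"] \<pi> by (simp add: A_def vimage_def)
  have B: "B n \<in> sets \<rho>" for n
    using measurable_sets[OF hr, of "{n}"] \<rho> by (simp add: B_def vimage_def)
  \<comment> \<open>If both cell masses vanish, 1 / 0 = 0 makes k n zero, so no case distinction is
    needed below.\<close>
  define k where "k n = 1 / max (measure \<pi> (A n)) (measure \<rho> (B n))" for n
  have k0: "0 \<le> k n" for n by (simp add: k_def le_max_iff_disj)
  \<comment> \<open>These two bounds are why the larger mass is the right divisor: they keep the
    first marginal of the glued measure below \<pi> and the second below \<rho>.\<close>
  have k1: "ennreal (k n) * emeasure \<pi> (A n) \<le> 1" "ennreal (k n) * emeasure \<rho> (B n) \<le> 1" for n
    unfolding p.emeasure_eq_measure r.emeasure_eq_measure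
    by (auto simp: k0 k_def divide_le_eq le_max_iff_disj simp flip: ennreal_mult)
  \<comment> \<open>A density with respect to the product of the plans, supported on pairs where the
    end of the first and the start of the second lie in the same cell.\<close>
  define g :: "('a \<times> 'a) \<times> ('a \<times> 'a) \<Rightarrow> ennreal" where "g w = ennreal (if h (snd (fst w)) = h (fst (snd w)) then k (h (snd (fst w))) else 0)" for w
  let ?P = "\<pi> \<Otimes>\<^sub>M \<rho>"
  have [measurable]: "g \<in> borel_measurable ?P"
  proof -
    \<comment> \<open>With the label p w fixed to a constant n the function depends on q alone;
      countably many labels are then put together.\<close>
    have "(\<lambda>w. ennreal (if p w = q w then k (p w) else 0)) \<in> borel_measurable ?P"
      if [measurable]: "p \<in> measurable ?P (count_space UNIV)" "q \<in> measurable ?P (count_space UNIV)"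
      for p q
      by (rule measurable_compose_countable[where f = "\<lambda>n w. ennreal (if n = q w then k n else 0)"])
        measurable
    from this[OF measurable_compose[OF measurable_fst hp] measurable_compose[OF measurable_snd hr]]
    show ?thesis
      unfolding g_def .
  qed
  have gr: "(\<integral>\<^sup>+v. g (u, v) \<partial>\<rho>) = ennreal (k (h (snd u))) * emeasure \<rho> (B (h (snd u)))" for u
  proof -
    have "g (u, v) = ennreal (k (h (snd u))) * indicator (B (h (snd u))) v" for v
      by (auto simp: g_def B_def indicator_def)
    then show ?thesis by (simp add: nn_integral_cmult_indicator B)
  qed
  have gp: "(\<integral>\<^sup>+u. g (u, v) \<partial>\<pi>) = ennreal (k (h (fst v))) * emeasure \<pi> (A (h (fst v)))" for v
  proof -
    have "g (u, v) = ennreal (k (h (fst v))) * indicator (A (h (fst v))) u" for u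
      by (auto simp: g_def A_def indicator_def)
    then show ?thesis by (simp add: nn_integral_cmult_indicator A)
  qed
  define G where "G = density ?P g"
  have sG [measurable_cong]: "sets G = sets ?P" by (simp add: G_def)
  have Gm [measurable]: "fst \<in> measurable G \<pi>" "snd \<in> measurable G \<rho>"
    by (simp_all add: measurable_cong_sets[OF sG refl])
  have G1: "(\<integral>\<^sup>+w. f (fst w) \<partial>G) \<le> (\<integral>\<^sup>+u. f u \<partial>\<pi>)" if [measurable]: "f \<in> borel_measurable \<pi>" for f
  proof -
    have "(\<integral>\<^sup>+w. f (fst w) \<partial>G) = (\<integral>\<^sup>+w. f (fst w) * g w \<partial>?P)"
      unfolding G_def by (simp add: nn_integral_density mult.commute)
    also have "\<dots> = (\<integral>\<^sup>+u. \<integral>\<^sup>+v. f u * g (u, v) \<partial>\<rho> \<partial>\<pi>)"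
      by (subst r.nn_integral_fst[symmetric]) simp_all
    also have "\<dots> = (\<integral>\<^sup>+u. f u * (\<integral>\<^sup>+v. g (u, v) \<partial>\<rho>) \<partial>\<pi>)"
      by (intro nn_integral_cong nn_integral_cmult) measurable
    also have "\<dots> \<le> (\<integral>\<^sup>+u. f u * 1 \<partial>\<pi>)"
      unfolding gr by (intro nn_integral_mono mult_left_mono k1) simp
    finally show ?thesis by simp
  qed
  have G2: "(\<integral>\<^sup>+w. f (snd w) \<partial>G) \<le> (\<integral>\<^sup>+v. f v \<partial>\<rho>)" if [measurable]: "f \<in> borel_measurable \<rho>" for f
  proof -
    have "(\<integral>\<^sup>+w. f (snd w) \<partial>G) = (\<integral>\<^sup>+w. f (snd w) * g w \<partial>?P)"
      unfolding G_def by (simp add: nn_integral_density mult.commute)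
    also have "\<dots> = (\<integral>\<^sup>+v. \<integral>\<^sup>+u. f v * g (u, v) \<partial>\<pi> \<partial>\<rho>)"
      by (subst pr.nn_integral_snd[symmetric]) simp_all
    also have "\<dots> = (\<integral>\<^sup>+v. f v * (\<integral>\<^sup>+u. g (u, v) \<partial>\<pi>) \<partial>\<rho>)"
      by (intro nn_integral_cong nn_integral_cmult) measurable
    also have "\<dots> \<le> (\<integral>\<^sup>+v. f v * 1 \<partial>\<rho>)"
      unfolding gp by (intro nn_integral_mono mult_left_mono k1) simp
    finally show ?thesis by simp
  qed
  have disj: "disjoint_family A" "disjoint_family B"
    by (auto simp: disjoint_family_on_def A_def B_def)
  have cover: "(\<Union>n. A n) = UNIV" "(\<Union>n. B n) = UNIV"
    by (auto simp: A_def B_def)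
  have mass_p: "emeasure \<pi> UNIV = (\<Sum>n. emeasure \<pi> (A n))"
    using suminf_emeasure[of A \<pi>] A disj cover by (simp add: image_subset_iff)
  have mass_r: "emeasure \<rho> UNIV = (\<Sum>n. emeasure \<rho> (B n))"
    using suminf_emeasure[of B \<rho>] B disj cover by (simp add: image_subset_iff)
  let ?q = "\<lambda>n. ennreal (k n) * emeasure \<rho> (B n)"
  have "emeasure G (space G) = (\<integral>\<^sup>+w. g w \<partial>?P)"
    by (simp add: G_def emeasure_density nn_integral_set_ennreal cong: nn_integral_cong)
  also have "\<dots> = (\<integral>\<^sup>+u. ?q (h (snd u)) \<partial>\<pi>)"
    by (simp add: gr flip: r.nn_integral_fst)
  also have "\<dots> = (\<integral>\<^sup>+u. (\<Sum>n. ?q n * indicator (A n) u) \<partial>\<pi>)"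
    by (intro nn_integral_cong suminf_cmult_indicator[symmetric] disj) (auto simp: A_def)
  also have "\<dots> = (\<Sum>n. ?q n * emeasure \<pi> (A n))"
    using A by (simp add: nn_integral_suminf nn_integral_cmult_indicator)
  finally have mass_G: "emeasure G (space G) = (\<Sum>n. ?q n * emeasure \<pi> (A n))" .
  define \<sigma> where "\<sigma> = sm_diff (marg2 \<pi>) (marg1 \<rho>)"
  have hs: "h -` {n} \<in> sets borel" for n
    using measurable_sets[OF h, of "{n}"] by simp
  have AB: "A n = snd -` (h -` {n})" "B n = fst -` (h -` {n})" for n
    by (auto simp: A_def B_def)
  have \<sigma>: "sm_apply \<sigma> (h -` {n}) = measure \<pi> (A n) - measure \<rho> (B n)" for n
    using \<pi> \<rho> hs by (simp add: \<sigma>_def sm_apply_sm_diff measure_def emeasure_marg AB)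
  have split: "emeasure \<pi> (A n) + emeasure \<rho> (B n) =
      2 * (?q n * emeasure \<pi> (A n)) + ennreal \<bar>sm_apply \<sigma> (h -` {n})\<bar>" for n
  proof -
    \<comment> \<open>The product is min x y, also when both vanish, so this is x + y = 2 min x y +
      |x - y|. The mass kept in a cell is the smaller of the two cell masses.\<close>
    have "x + y = 2 * (1 / max x y * y * x) + \<bar>x - y\<bar>" if "0 \<le> x" "0 \<le> y" for x y :: real
      using that by (cases "x = 0"; cases "y = 0"; cases "x \<le> y") (auto simp: max_def)
    from this[OF measure_nonneg measure_nonneg]
    have "measure \<pi> (A n) + measure \<rho> (B n) =
      2 * (k n * measure \<rho> (B n) * measure \<pi> (A n)) + \<bar>measure \<pi> (A n) - measure \<rho> (B n)\<bar>"
      unfolding k_def .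
    then have "ennreal (measure \<pi> (A n) + measure \<rho> (B n)) =
      ennreal (2 * (k n * measure \<rho> (B n) * measure \<pi> (A n)) + \<bar>measure \<pi> (A n) - measure \<rho> (B n)\<bar>)"
      by simp
    then show ?thesis
      unfolding \<sigma> p.emeasure_eq_measure r.emeasure_eq_measure
      by (simp add: k0 ennreal_mult)
  qed
  have "emeasure \<pi> UNIV + emeasure \<rho> UNIV = (\<Sum>n. emeasure \<pi> (A n) + emeasure \<rho> (B n))"
    by (simp add: mass_p mass_r suminf_add)
  also have "\<dots> = 2 * emeasure G (space G) + (\<Sum>n. ennreal \<bar>sm_apply \<sigma> (h -` {n})\<bar>)"
    unfolding mass_G by (simp add: split flip: suminf_add)
  also have "\<dots> \<le> 2 * emeasure G (space G) + total_variation \<sigma>"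
    using hs by (intro add_left_mono total_variation_upper) (auto simp: disjoint_family_on_def)
  finally have mass: "emeasure \<pi> UNIV + emeasure \<rho> UNIV \<le> 2 * emeasure G (space G) + total_variation \<sigma>" .

  have G_le: "emeasure G (space G) \<le> emeasure \<pi> UNIV"
    using G1[of "\<lambda>_. 1"] \<pi> by simp
  \<comment> \<open>Only the start of the first plan and the end of the second are kept; both middle
    points are forgotten.\<close>
  define j :: "('a \<times> 'a) \<times> ('a \<times> 'a) \<Rightarrow> 'a \<times> 'a" where "j w = (fst (fst w), snd (snd w))" for w
  have j [measurable]: "j \<in> borel_measurable G"
    unfolding j_def using measurable_compose[OF Gm(1) fs(1)] measurable_compose[OF Gm(2) fs(4)]
    by (rule borel_measurable_Pair)
  define \<gamma> where "\<gamma> = distr G borel j"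
  have U: "emeasure \<gamma> UNIV = emeasure G (space G)"
    by (simp add: \<gamma>_def emeasure_distr)
  have \<gamma>: "\<gamma> \<in> finite_borel"
  proof (rule finite_borelI)
    have "emeasure \<gamma> UNIV \<le> emeasure \<pi> UNIV" using G_le U by simp
    then show "emeasure \<gamma> UNIV \<noteq> top" using \<pi> by (metis finite_borel_finite(2) top.extremum_unique)
  qed (simp add: \<gamma>_def)
  have m1: "emeasure (marg1 \<gamma>) C \<le> emeasure (marg1 \<pi>) C" if C: "C \<in> sets borel" for C
  proof -
    have [measurable]: "(\<lambda>u. indicator C (fst u) :: ennreal) \<in> borel_measurable \<pi>"
      using C by measurable
    have bm: "(\<lambda>z. indicator C (fst z) :: ennreal) \<in> borel_measurable (borel :: ('a \<times> 'a) measure)"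
      by (rule measurable_compose[OF borel_measurable_fst_snd(1)[OF refl] borel_measurable_indicator[OF C]])
    have "emeasure (marg1 \<gamma>) C = (\<integral>\<^sup>+w. indicator C (fst (fst w)) \<partial>G)"
      using C \<gamma> j bm by (simp add: emeasure_marg_nn_integral \<gamma>_def nn_integral_distr) (simp add: j_def)
    also have "\<dots> \<le> (\<integral>\<^sup>+u. indicator C (fst u) \<partial>\<pi>)"
      by (rule G1[of "\<lambda>u. indicator C (fst u)"]) simp
    also have "\<dots> = emeasure (marg1 \<pi>) C"
      using C \<pi> by (simp add: emeasure_marg_nn_integral)
    finally show ?thesis .
  qed
  have m2: "emeasure (marg2 \<gamma>) C \<le> emeasure (marg2 \<rho>) C" if C: "C \<in> sets borel" for C
  proof -
    have [measurable]: "(\<lambda>u. indicator C (snd u) :: ennreal) \<in> borel_measurable \<rho>"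
      using C by measurable
    have bm: "(\<lambda>z. indicator C (snd z) :: ennreal) \<in> borel_measurable (borel :: ('a \<times> 'a) measure)"
      by (rule measurable_compose[OF borel_measurable_fst_snd(2)[OF refl] borel_measurable_indicator[OF C]])
    have "emeasure (marg2 \<gamma>) C = (\<integral>\<^sup>+w. indicator C (snd (snd w)) \<partial>G)"
      using C \<gamma> j bm by (simp add: emeasure_marg_nn_integral \<gamma>_def nn_integral_distr) (simp add: j_def)
    also have "\<dots> \<le> (\<integral>\<^sup>+u. indicator C (snd u) \<partial>\<rho>)"
      by (rule G2[of "\<lambda>u. indicator C (snd u)"]) simp
    also have "\<dots> = emeasure (marg2 \<rho>) C"
      using C \<rho> by (simp add: emeasure_marg_nn_integral)
    finally show ?thesis .
  qed
  let ?t1 = "total_variation (sm_diff (marg1 \<pi>) (marg1 \<gamma>))"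
  let ?t2 = "total_variation (sm_diff (marg2 \<rho>) (marg2 \<gamma>))"
  have "?t1 + emeasure \<gamma> UNIV \<le> emeasure \<pi> UNIV"
    using total_variation_sm_diff_dominated[OF _ _ m1] \<pi> \<gamma> by (simp add: emeasure_marg)
  moreover have "?t2 + emeasure \<gamma> UNIV \<le> emeasure \<rho> UNIV"
    using total_variation_sm_diff_dominated[OF _ _ m2] \<rho> \<gamma> by (simp add: emeasure_marg)
  \<comment> \<open>The mass discarded on the two sides is at most |\<pi>| + |\<rho>| - 2|\<gamma>|,
    which \<open>mass\<close> bounds by the discrepancy of the middle marginals.\<close>
  ultimately have "(?t1 + emeasure \<gamma> UNIV) + (?t2 + emeasure \<gamma> UNIV) \<le> emeasure \<pi> UNIV + emeasure \<rho> UNIV"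
    by (rule add_mono)
  also note mass
  finally have "2 * emeasure \<gamma> UNIV + (?t1 + ?t2) \<le> 2 * emeasure \<gamma> UNIV + total_variation \<sigma>"
    by (simp add: U mult_2 ac_simps)
  then have tv: "?t1 + ?t2 \<le> total_variation \<sigma>"
    using \<gamma> by (simp add: ennreal_add_left_cancel_le ennreal_mult_eq_top_iff)

  let ?c = "\<lambda>z :: 'a \<times> 'a. ennreal (norm (fst z - snd z))"
  have [measurable]: "?c \<in> borel_measurable \<pi>" "?c \<in> borel_measurable \<rho>"
    by measurable
  have "transport_cost \<gamma> = (\<integral>\<^sup>+w. ennreal (norm (fst (fst w) - snd (snd w))) \<partial>G)"
    by (simp add: transport_cost_def \<gamma>_def nn_integral_distr j_def)
  \<comment> \<open>Almost everywhere for G the two middle points share a cell, so the jump between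
    them adds less than e per unit of mass.\<close>
  also have "\<dots> \<le> (\<integral>\<^sup>+w. ?c (fst w) + ?c (snd w) + ennreal e \<partial>G)"
  proof (rule nn_integral_mono_AE)
    have "norm (x - z) \<le> norm (x - y) + norm (y' - z) + e" if "dist y y' < e" for x y y' z :: 'a
      using that norm_triangle_ineq[of "x - y" "y - z"] norm_triangle_ineq[of "y - y'" "y' - z"]
      by (simp add: dist_norm)
    then show "AE w in G. ennreal (norm (fst (fst w) - snd (snd w))) \<le> ?c (fst w) + ?c (snd w) + ennreal e"
      unfolding G_def using cell e
      by (subst AE_density) (auto simp: g_def simp flip: ennreal_plus intro!: ennreal_leI)
  qed
  also have "\<dots> = (\<integral>\<^sup>+w. ?c (fst w) \<partial>G) + (\<integral>\<^sup>+w. ?c (snd w) \<partial>G) + ennreal e * emeasure G (space G)"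
    by (simp add: nn_integral_add)
  also have "\<dots> \<le> transport_cost \<pi> + transport_cost \<rho> + ennreal e * emeasure \<pi> UNIV"
    unfolding transport_cost_def by (intro add_mono G1 G2 mult_left_mono G_le) auto
  finally show ?thesis
    using that[OF \<gamma>] tv unfolding \<sigma>_def by blast
qed

section \<open>Triangle inequality and translation invariance\<close>

text \<open>Gluing may discard additional mass, but no more than the middle marginals differ by, and
  that difference is already paid for by the two total variation terms at N. Of the three parts of
  e, two cover near-optimality and one the cell size.\<close>

lemma gen_wasserstein_triangle:
  assumes a: "0 < a" and b: "0 < b"
    and fin: "M \<in> finite_borel" "N \<in> finite_borel" "P \<in> finite_borel"
  shows "gen_wasserstein a b M P \<le> gen_wasserstein a b M N + gen_wasserstein a b N P"
proof (rule ennreal_le_epsilon)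
  fix e :: real assume e: "0 < e"
  have "gen_wasserstein a b M N < gen_wasserstein a b M N + ennreal (e / 3)"
    "gen_wasserstein a b N P < gen_wasserstein a b N P + ennreal (e / 3)"
    using e fin gen_wasserstein_finite[of _ _ a b] by (auto simp: less_top)
  then obtain \<pi> \<rho> where
    \<pi>: "\<pi> \<in> finite_borel" "plan_cost a b M N \<pi> < gen_wasserstein a b M N + ennreal (e / 3)" and
    \<rho>: "\<rho> \<in> finite_borel" "plan_cost a b N P \<rho> < gen_wasserstein a b N P + ennreal (e / 3)"
    by (metis b gen_wasserstein_approx_plan)
  \<comment> \<open>The cell size is chosen so that the gluing error b * d * |\<pi>| stays below e /
    3; the summand 1 covers a null plan.\<close>
  define d where "d = (e / 3) / (b * measure \<pi> UNIV + 1)"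
  have m: "0 < b * measure \<pi> UNIV + 1" using b by (simp add: add_nonneg_pos)
  then have "0 < d" using e by (simp add: d_def)
  have "b * (d * measure \<pi> UNIV) \<le> e / 3"
  proof -
    have "b * (d * measure \<pi> UNIV) \<le> d * (b * measure \<pi> UNIV + 1)"
      using \<open>0 < d\<close> by (simp add: algebra_simps)
    also have "d * (b * measure \<pi> UNIV + 1) = e / 3"
      using m d_def nonzero_eq_divide_eq[of "b * measure \<pi> UNIV + 1" d "e / 3"] by auto
    finally show ?thesis .
  qed
  then have slack: "ennreal b * (ennreal d * emeasure \<pi> UNIV) \<le> ennreal (e / 3)"
    using \<pi>(1) b \<open>0 < d\<close> by (simp add: finite_borel_emeasure ennreal_leI flip: ennreal_mult)
  obtain \<gamma> where \<gamma>: "\<gamma> \<in> finite_borel"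
    "total_variation (sm_diff (marg1 \<pi>) (marg1 \<gamma>)) + total_variation (sm_diff (marg2 \<rho>) (marg2 \<gamma>))
       \<le> total_variation (sm_diff (marg2 \<pi>) (marg1 \<rho>))"
    "transport_cost \<gamma> \<le> transport_cost \<pi> + transport_cost \<rho> + ennreal d * emeasure \<pi> UNIV"
    by (rule glue_plans[OF \<pi>(1) \<rho>(1) \<open>0 < d\<close>])
  let ?M = "total_variation (sm_diff M (marg1 \<pi>))" and ?N1 = "total_variation (sm_diff N (marg2 \<pi>))"
  let ?N2 = "total_variation (sm_diff N (marg1 \<rho>))" and ?P = "total_variation (sm_diff P (marg2 \<rho>))"
  have "total_variation (sm_diff M (marg1 \<gamma>)) + total_variation (sm_diff P (marg2 \<gamma>)) \<le>
      (?M + total_variation (sm_diff (marg1 \<pi>) (marg1 \<gamma>))) +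
      (?P + total_variation (sm_diff (marg2 \<rho>) (marg2 \<gamma>)))"
    using fin \<pi> \<rho> \<gamma> by (intro add_mono total_variation_sm_diff_triangle) auto
  also have "\<dots> \<le> (?M + ?P) + total_variation (sm_diff (marg2 \<pi>) (marg1 \<rho>))"
    using add_left_mono[OF \<gamma>(2), of "?M + ?P"] by (simp add: ac_simps)
  also have "total_variation (sm_diff (marg2 \<pi>) (marg1 \<rho>)) \<le> ?N1 + ?N2"
    using total_variation_sm_diff_triangle[of "marg2 \<pi>" N "marg1 \<rho>"] fin \<pi> \<rho>
    by (simp add: total_variation_sm_diff_commute[of "marg2 \<pi>" N])
  finally have "total_variation (sm_diff M (marg1 \<gamma>)) + total_variation (sm_diff P (marg2 \<gamma>)) \<le>
      (?M + ?P) + (?N1 + ?N2)"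
    by (simp add: add_left_mono)
  then have "plan_cost a b M P \<gamma> \<le> ennreal a * ((?M + ?P) + (?N1 + ?N2)) +
      ennreal b * (transport_cost \<pi> + transport_cost \<rho> + ennreal d * emeasure \<pi> UNIV)"
    unfolding plan_cost_def using \<gamma>(3) by (intro add_mono[OF mult_left_mono mult_left_mono]) auto
  also have "\<dots> = plan_cost a b M N \<pi> + plan_cost a b N P \<rho> + ennreal b * (ennreal d * emeasure \<pi> UNIV)"
    by (simp add: plan_cost_def distrib_left ac_simps)
  also have "\<dots> \<le> (gen_wasserstein a b M N + ennreal (e / 3)) + (gen_wasserstein a b N P + ennreal (e / 3))
      + ennreal (e / 3)"
    using \<pi> \<rho> slack by (intro add_mono) auto
  also have "\<dots> = (gen_wasserstein a b M N + gen_wasserstein a b N P) +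
      (ennreal (e / 3) + ennreal (e / 3) + ennreal (e / 3))"
    by (simp add: ac_simps)
  also have "ennreal (e / 3) + ennreal (e / 3) + ennreal (e / 3) = ennreal e"
    using e by (simp flip: ennreal_plus)
  finally show "gen_wasserstein a b M P \<le> gen_wasserstein a b M N + gen_wasserstein a b N P + ennreal e"
    using gen_wasserstein_le_plan_cost[OF \<gamma>(1)] by (metis order_trans)
qed

lemma gen_wasserstein_self: "M \<in> finite_borel \<Longrightarrow> gen_wasserstein a b M M = 0"
  using gen_wasserstein_diagonal[of M M a b] by (simp add: sm_diff_self)

text \<open>The easy half of invariance: subadditivity with the pair (L, L), whose distance is
  0.\<close>

lemma gen_wasserstein_translate_le:
  assumes "0 < b" "M \<in> finite_borel" "N \<in> finite_borel" "L \<in> finite_borel"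
  shows "gen_wasserstein a b (add_measure M L) (add_measure N L) \<le> gen_wasserstein a b M N"
  using gen_wasserstein_add_le[of b M N L L a] assms by (simp add: gen_wasserstein_self)

text \<open>Each exchange of one M for one N may use the same L and leaves it intact, so a single
  copy suffices for all n exchanges.\<close>

lemma gen_wasserstein_multiple_translate_le:
  assumes a: "0 < a" and b: "0 < b"
    and fin: "M \<in> finite_borel" "N \<in> finite_borel" "L \<in> finite_borel"
  shows "gen_wasserstein a b (add_measure (scale_measure (ennreal (real n)) M) L)
      (add_measure (scale_measure (ennreal (real n)) N) L)
    \<le> of_nat n * gen_wasserstein a b (add_measure M L) (add_measure N L)"
proof (induction n)
  case 0
  have "add_measure (scale_measure (ennreal (real 0)) M) L = add_measure (scale_measure (ennreal (real 0)) N) L"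
    using fin by (intro measure_eqI) (simp_all add: emeasure_add_measure)
  then show ?case
    using fin gen_wasserstein_self[of "add_measure (scale_measure (ennreal (real 0)) N) L" a b]
    by (simp only: add_measure_finite_borel scale_measure_finite_borel) simp
next
  case (Suc n)
  let ?m = "scale_measure (ennreal (real n)) M" and ?n = "scale_measure (ennreal (real n)) N"
  let ?d = "gen_wasserstein a b"
  have f: "?m \<in> finite_borel" "?n \<in> finite_borel"
    using fin by (auto intro: scale_measure_finite_borel)
  have fa: "add_measure X Y \<in> finite_borel" if "X \<in> finite_borel" "Y \<in> finite_borel" for X Y :: "'a measure"
    using that by (rule add_measure_finite_borel)
  have perm: "add_measure (add_measure X Y) Z = add_measure (add_measure X Z) Y"
    "add_measure (add_measure X Y) Z = add_measure (add_measure Y Z) X"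
    if "X \<in> finite_borel" "Y \<in> finite_borel" "Z \<in> finite_borel" for X Y Z :: "'a measure"
    using that by (metis add_measure_assoc add_measure_commute finite_borel_sets)+
  \<comment> \<open>The intermediate measure is N + nM + L. The first leg is the pair (M + L, N + L)
    translated by nM, the second is the pair of the induction hypothesis translated by N.\<close>
  have "?d (add_measure (add_measure M ?m) L) (add_measure (add_measure N ?n) L) \<le>
      ?d (add_measure (add_measure M ?m) L) (add_measure (add_measure N ?m) L) +
      ?d (add_measure (add_measure N ?m) L) (add_measure (add_measure N ?n) L)"
    using a b fin f fa by (intro gen_wasserstein_triangle) auto
  also have "?d (add_measure (add_measure M ?m) L) (add_measure (add_measure N ?m) L) \<le>
      ?d (add_measure M L) (add_measure N L)"
    using b fin f fa gen_wasserstein_translate_le[of b "add_measure M L" "add_measure N L" ?m a]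
    by (simp add: perm(1)[of _ ?m L])
  also have "?d (add_measure (add_measure N ?m) L) (add_measure (add_measure N ?n) L) \<le>
      ?d (add_measure ?m L) (add_measure ?n L)"
    using b fin f fa gen_wasserstein_translate_le[of b "add_measure ?m L" "add_measure ?n L" N a]
    by (simp add: perm(2)[of N _ L])
  also note Suc.IH
  finally show ?case
    unfolding scale_measure_Suc[OF finite_borel_sets[OF fin(1)]] scale_measure_Suc[OF finite_borel_sets[OF fin(2)]]
    by (simp add: distrib_right add_left_mono add_right_mono)
qed

text \<open>
  Adding \<open>L\<close> to both arguments of the \<open>n\<close>-fold multiples costs at most a constant, which
  disappears after division by \<open>n\<close>. No duality theorem is needed.
\<close>

lemma gen_wasserstein_translate:
  assumes a: "0 < a" and b: "0 < b"
    and fin: "M \<in> finite_borel" "N \<in> finite_borel" "L \<in> finite_borel"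
  shows "gen_wasserstein a b (add_measure M L) (add_measure N L) = gen_wasserstein a b M N"
proof (rule antisym)
  let ?d = "gen_wasserstein a b"
  define c where "c = a * measure L UNIV"
  have "0 \<le> c" using a by (simp add: c_def)
  define x y where "x = enn2real (?d M N)" and "y = enn2real (?d (add_measure M L) (add_measure N L))"
  have x: "?d M N = ennreal x" and y: "?d (add_measure M L) (add_measure N L) = ennreal y"
    and pos: "0 \<le> x" "0 \<le> y"
    using fin by (simp_all add: x_def y_def gen_wasserstein_finite add_measure_finite_borel)
  have bound: "real n * x \<le> real n * y + 2 * c" if n: "0 < n" for n
  proof -
    let ?m = "scale_measure (ennreal (real n)) M" and ?n = "scale_measure (ennreal (real n)) N"
    have f: "?m \<in> finite_borel" "?n \<in> finite_borel" "add_measure ?m L \<in> finite_borel" "add_measure ?n L \<in> finite_borel"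
      using fin by (auto intro: scale_measure_finite_borel add_measure_finite_borel)
    \<comment> \<open>Inserting L costs at most c = a|L|, whatever X is. It is used once at each
      end, hence the term 2 * c.\<close>
    have shift: "?d X (add_measure X L) \<le> ennreal c" if "X \<in> finite_borel" for X
    proof -
      have "?d X (add_measure X L) \<le> ennreal a * total_variation (sm_diff X (add_measure X L))"
        using that fin by (intro gen_wasserstein_diagonal add_measure_finite_borel)
      also have "\<dots> \<le> ennreal a * emeasure L UNIV"
        using that fin by (intro mult_left_mono total_variation_sm_diff_add_measure) auto
      also have "\<dots> = ennreal c"
        using a fin by (simp add: c_def finite_borel_emeasure ennreal_mult)
      finally show ?thesis .
    qed
    \<comment> \<open>Homogeneity is available only as an upper bound; shrinking the n-fold
      multiples by 1 / n turns it into the lower bound n * x on their distance.\<close>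
    have "ennreal x = ?d (scale_measure (ennreal (1 / real n)) ?m) (scale_measure (ennreal (1 / real n)) ?n)"
      using n by (simp only: scale_measure_inverse of_nat_0_less_iff x)
    also have "\<dots> \<le> ennreal (1 / real n) * ?d ?m ?n"
      using b f by (intro gen_wasserstein_scale_le) auto
    finally have "ennreal x \<le> ennreal (1 / real n) * ?d ?m ?n" .
    also have "?d ?m ?n \<le> ?d ?m (add_measure ?m L) + ?d (add_measure ?m L) ?n"
      using a b f by (intro gen_wasserstein_triangle)
    also have "?d (add_measure ?m L) ?n \<le> ?d (add_measure ?m L) (add_measure ?n L) + ?d (add_measure ?n L) ?n"
      using a b f by (intro gen_wasserstein_triangle)
    also have "?d (add_measure ?n L) ?n = ?d ?n (add_measure ?n L)"
      using b by (rule gen_wasserstein_commute)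
    also have "?d ?m (add_measure ?m L) + (?d (add_measure ?m L) (add_measure ?n L) + ?d ?n (add_measure ?n L))
        \<le> ennreal c + (of_nat n * ennreal y + ennreal c)"
      using gen_wasserstein_multiple_translate_le[OF a b fin, of n] f
      by (intro add_mono shift) (simp_all add: y)
    also have "\<dots> = ennreal (real n * y + 2 * c)"
      using pos \<open>0 \<le> c\<close> by (simp add: ennreal_of_nat_eq_real_of_nat add.commute flip: ennreal_mult ennreal_plus)
    finally have "ennreal x \<le> ennreal (1 / real n) * ennreal (real n * y + 2 * c)"
      by (simp add: add_left_mono mult_left_mono)
    also have "\<dots> = ennreal ((1 / real n) * (real n * y + 2 * c))"
      using pos \<open>0 \<le> c\<close> by (intro ennreal_mult[symmetric]) auto
    finally have "x \<le> (1 / real n) * (real n * y + 2 * c)"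
      using pos \<open>0 \<le> c\<close> by (subst (asm) ennreal_le_iff) auto
    then show ?thesis
      using n by (simp add: field_simps)
  qed
  have "x \<le> y"
  \<comment> \<open>If x exceeded y, then n * (x - y) would outgrow the fixed number 2 * c.\<close>
  proof (rule ccontr)
    assume "\<not> x \<le> y"
    then obtain n where n: "2 * c < real n * (x - y)"
      using reals_Archimedean3[of "x - y"] by auto
    then have "0 < n" using \<open>0 \<le> c\<close> by (cases n) auto
    then show False using bound[of n] n by (simp add: algebra_simps)
  qed
  then show "?d M N \<le> ?d (add_measure M L) (add_measure N L)"
    by (simp add: x y ennreal_leI)
  show "?d (add_measure M L) (add_measure N L) \<le> ?d M N"
    using b fin by (intro gen_wasserstein_translate_le)
qed

text \<open>Translating (M, N) by N' and (M', N') by N produces the same pair, because M + N' = M' +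
  N.\<close>

lemma gen_wasserstein_cong_sm_diff:
  assumes a: "0 < a" and b: "0 < b"
    and fin: "M \<in> finite_borel" "N \<in> finite_borel" "M' \<in> finite_borel" "N' \<in> finite_borel"
    and eq: "sm_diff M N = sm_diff M' N'"
  shows "gen_wasserstein a b M N = gen_wasserstein a b M' N'"
proof -
  have "gen_wasserstein a b M N = gen_wasserstein a b (add_measure M N') (add_measure N N')"
    using a b fin by (simp add: gen_wasserstein_translate)
  also have "\<dots> = gen_wasserstein a b (add_measure M' N) (add_measure N' N)"
    using eq fin by (simp add: sm_diff_eq_iff add_measure_commute[of N N'])
  also have "\<dots> = gen_wasserstein a b M' N'"
    using a b fin by (simp add: gen_wasserstein_translate)
  finally show ?thesis .
qed

section \<open>Definiteness\<close>

text \<open>Mass that the plan takes from C either ends in the e-neighbourhood or travels at least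
  e. The latter is bounded by the transport cost over e, and the mass the plan ignores by the total
  variation terms.\<close>

lemma emeasure_neighbourhood_le_plan_cost:
  fixes M :: "'a::euclidean_space measure"
  assumes a: "0 < a" and b: "0 < b" and e: "0 < e"
    and fin: "M \<in> finite_borel" "N \<in> finite_borel" "\<pi> \<in> finite_borel" and C: "closed C"
  shows "emeasure M C \<le> emeasure N (\<Union>x\<in>C. ball x e) +
    ennreal (max (1 / a) (1 / (b * e))) * plan_cost a b M N \<pi>"
proof -
  let ?D = "\<Union>x\<in>C. ball x e"
  let ?K = "max (1 / a) (1 / (b * e))"
  let ?tM = "total_variation (sm_diff M (marg1 \<pi>))" and ?tN = "total_variation (sm_diff N (marg2 \<pi>))"
  have bC: "C \<in> sets borel" using C by simp
  have bD: "?D \<in> sets borel" by (intro borel_open open_UN) auto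
  have sp: "sets \<pi> = sets borel" "space \<pi> = UNIV" using fin by auto
  let ?F = "{z \<in> (UNIV :: ('a \<times> 'a) set). 1 \<le> ennreal (1 / e) * ennreal (norm (fst z - snd z))}"
  have m: "snd -` ?D \<in> sets \<pi>"
    using measurable_sets[OF borel_measurable_fst_snd(2)[OF sp(1)] bD] sp(2) by simp
  have mF: "?F \<in> sets \<pi>"
  proof -
    have [measurable]: "(\<lambda>z. norm (fst z - snd z)) \<in> borel_measurable \<pi>"
      using sp by simp
    have "{z \<in> space \<pi>. 1 \<le> ennreal (1 / e) * ennreal (norm (fst z - snd z))} \<in> sets \<pi>"
      by measurable
    then show ?thesis by (simp add: sp)
  qed
  have "emeasure M C \<le> emeasure (marg1 \<pi>) C + ?tM"
    using fin bC by (intro emeasure_le_total_variation) auto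
  also have "emeasure (marg1 \<pi>) C = emeasure \<pi> (fst -` C)"
    using fin bC by (simp add: emeasure_marg)
  also have "\<dots> \<le> emeasure \<pi> (snd -` ?D \<union> ?F)"
  proof (rule emeasure_mono)
    show "fst -` C \<subseteq> snd -` ?D \<union> ?F"
    proof
      fix z :: "'a \<times> 'a" assume "z \<in> fst -` C"
      moreover have "z \<in> ?F" if "e \<le> norm (fst z - snd z)"
        using e that by (simp flip: ennreal_mult)
      ultimately show "z \<in> snd -` ?D \<union> ?F"
        by (auto simp: dist_norm intro!: bexI[of _ "fst z"] simp: not_le[symmetric])
    qed
  qed (use m mF in auto)
  also have "\<dots> \<le> emeasure \<pi> (snd -` ?D) + emeasure \<pi> ?F"
    by (rule emeasure_subadditive[OF m mF])
  also have "emeasure \<pi> (snd -` ?D) = emeasure (marg2 \<pi>) ?D"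
    using fin bD by (simp add: emeasure_marg)
  also have "\<dots> \<le> emeasure N ?D + total_variation (sm_diff (marg2 \<pi>) N)"
    using fin bD by (intro emeasure_le_total_variation) auto
  also have "total_variation (sm_diff (marg2 \<pi>) N) = ?tN"
    using fin by (simp add: total_variation_sm_diff_commute)
  also have "emeasure \<pi> ?F \<le> ennreal (1 / e) * transport_cost \<pi>"
    using nn_integral_Markov_inequality[of "\<lambda>z. ennreal (norm (fst z - snd z))" UNIV \<pi> "ennreal (1 / e)"]
      sp by (simp add: transport_cost_def)
  finally have "emeasure M C \<le> emeasure N ?D + ?tN + ennreal (1 / e) * transport_cost \<pi> + ?tM"
    by (simp add: add_left_mono add_right_mono)
  also have "\<dots> = emeasure N ?D + ((?tM + ?tN) + ennreal (1 / e) * transport_cost \<pi>)"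
    by (simp add: ac_simps)
  \<comment> \<open>The maximum in \<open>?K\<close> makes \<open>?K * a\<close> at least 1 and
    \<open>?K * b\<close> at least 1 / e, so one multiple of the plan cost absorbs both kinds of
    error.\<close>
  also have "\<dots> \<le> emeasure N ?D + (ennreal (?K * a) * (?tM + ?tN) + ennreal (?K * b) * transport_cost \<pi>)"
  proof (intro add_left_mono add_mono mult_right_mono)
    have "1 / a * a \<le> ?K * a" using a by (intro mult_right_mono) auto
    then have "ennreal 1 \<le> ennreal (?K * a)" using a by (intro ennreal_leI) simp
    then show "?tM + ?tN \<le> ennreal (?K * a) * (?tM + ?tN)"
      using mult_right_mono[of 1 "ennreal (?K * a)" "?tM + ?tN"] by simp
    have "1 / (b * e) * b \<le> ?K * b" using b by (intro mult_right_mono) auto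
    then show "ennreal (1 / e) \<le> ennreal (?K * b)" using b e by (intro ennreal_leI) simp
  qed simp
  also have "ennreal (?K * a) * (?tM + ?tN) + ennreal (?K * b) * transport_cost \<pi> =
      ennreal ?K * plan_cost a b M N \<pi>"
    using a b by (simp add: plan_cost_def distrib_left ennreal_mult le_max_iff_disj mult.assoc)
  finally show ?thesis .
qed

text \<open>For a fixed radius the cost of the plans can be made arbitrarily small. Afterwards the
  radius shrinks: the neighbourhoods decrease to C because C is closed, and N, being finite, is
  continuous from above.\<close>

lemma gen_wasserstein_eq_0_closed_le:
  fixes M :: "'a::euclidean_space measure"
  assumes a: "0 < a" and b: "0 < b" and fin: "M \<in> finite_borel" "N \<in> finite_borel"
    and zero: "gen_wasserstein a b M N = 0" and C: "closed C"
  shows "emeasure M C \<le> emeasure N C"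
proof -
  have le: "emeasure M C \<le> emeasure N (\<Union>x\<in>C. ball x e)" if e: "0 < e" for e
  proof (rule ennreal_le_epsilon)
    fix d :: real assume d: "0 < d"
    let ?K = "max (1 / a) (1 / (b * e))"
    have K: "0 < ?K" using a by (simp add: less_max_iff_disj)
    \<comment> \<open>\<open>?K\<close> grows as e shrinks, so the plan is chosen only after e,
      cheap enough to compensate the factor.\<close>
    then have "gen_wasserstein a b M N < ennreal (d / ?K)" using zero d by simp
    then obtain \<pi> where \<pi>: "\<pi> \<in> finite_borel" "plan_cost a b M N \<pi> < ennreal (d / ?K)"
      by (rule gen_wasserstein_approx_plan[OF b])
    have "emeasure M C \<le> emeasure N (\<Union>x\<in>C. ball x e) + ennreal ?K * plan_cost a b M N \<pi>"
      using a b e fin \<pi> C by (intro emeasure_neighbourhood_le_plan_cost)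
    also have "\<dots> \<le> emeasure N (\<Union>x\<in>C. ball x e) + ennreal ?K * ennreal (d / ?K)"
      using \<pi> by (intro add_left_mono mult_left_mono) auto
    also have "ennreal ?K * ennreal (d / ?K) = ennreal (?K * (d / ?K))"
      using K d by (intro ennreal_mult[symmetric]) auto
    also have "?K * (d / ?K) = d" using K by simp
    finally show "emeasure M C \<le> emeasure N (\<Union>x\<in>C. ball x e) + ennreal d" .
  qed
  define D where "D n = (\<Union>x\<in>C. ball x (1 / real (Suc n)))" for n
  have "(\<Inter>n. D n) = C"
  proof (intro equalityI subsetI)
    fix y assume y: "y \<in> (\<Inter>n. D n)"
    have "y \<in> closure C"
      unfolding closure_approachable
    proof (intro allI impI)
      fix e :: real assume "0 < e"
      then obtain n where "1 / real (Suc n) < e" by (rule nat_approx_posE)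
      moreover have "y \<in> D n" using y by blast
      ultimately show "\<exists>x\<in>C. dist x y < e" unfolding D_def by force
    qed
    then show "y \<in> C" using C by simp
  next
    fix y assume "y \<in> C"
    moreover have "y \<in> ball y (1 / real (Suc n))" for n by simp
    ultimately show "y \<in> (\<Inter>n. D n)" unfolding D_def by blast
  qed
  moreover have "(INF n. emeasure N (D n)) = emeasure N (\<Inter>n. D n)"
  proof (rule INF_emeasure_decseq)
    show "range D \<subseteq> sets N" using fin by (auto simp: D_def intro!: borel_open)
    have "ball x (1 / real (Suc n)) \<subseteq> ball x (1 / real (Suc m))" if "m \<le> n" for m n and x :: 'a
      using that by (intro subset_ball frac_le) auto
    then show "decseq D" unfolding D_def decseq_def by blast
  qed (use fin in simp)
  moreover have "emeasure M C \<le> (INF n. emeasure N (D n))"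
    unfolding D_def by (intro INF_greatest le) simp
  ultimately show ?thesis by simp
qed

text \<open>By symmetry M and N agree on closed sets, an intersection-stable generator of the Borel
  sets; the whole space is closed and has finite mass, so it serves as the exhausting
  sequence.\<close>

lemma gen_wasserstein_eq_0_iff:
  fixes M N :: "'a::euclidean_space measure"
  assumes a: "0 < a" and b: "0 < b" and fin: "M \<in> finite_borel" "N \<in> finite_borel"
  shows "gen_wasserstein a b M N = 0 \<longleftrightarrow> M = N"
proof
  assume zero: "gen_wasserstein a b M N = 0"
  have "emeasure M C = emeasure N C" if "closed C" for C
    using gen_wasserstein_eq_0_closed_le[OF a b fin zero that]
      gen_wasserstein_eq_0_closed_le[OF a b fin(2,1) _ that] zero b
    by (simp add: gen_wasserstein_commute[of b a N M])
  moreover have "sets borel = sigma_sets UNIV (Collect closed :: 'a set set)"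
    unfolding borel_eq_closed by simp
  ultimately show "M = N"
    using fin
    by (intro measure_eqI_generator_eq[where E = "Collect closed" and \<Omega> = UNIV and A = "\<lambda>_. UNIV"])
      (auto simp: Int_stable_def)
qed (use fin in \<open>simp add: gen_wasserstein_self\<close>)

section \<open>The norm\<close>

text \<open>The decomposition selected by \<open>SOME\<close> has the same difference as (M, N),
  hence the same distance; finiteness ensures that \<open>enn2real\<close> loses nothing.\<close>

lemma gw_norm_eq:
  assumes a: "0 < a" and b: "0 < b" and \<mu>: "(M, N) \<in> decompositions \<mu>"
  shows "ennreal (gw_norm a b \<mu>) = gen_wasserstein a b M N"
proof -
  obtain M' N' where eq: "(SOME p. p \<in> decompositions \<mu>) = (M', N')" by fastforce
  then have d: "(M', N') \<in> decompositions \<mu>" using someI[of "\<lambda>p. p \<in> decompositions \<mu>", OF \<mu>] by simp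
  then have "ennreal (gw_norm a b \<mu>) = gen_wasserstein a b M' N'"
    unfolding gw_norm_def eq by (simp add: decompositions_def gen_wasserstein_finite)
  also have "\<dots> = gen_wasserstein a b M N"
    using d \<mu> a b by (intro gen_wasserstein_cong_sm_diff) (auto simp: decompositions_def)
  finally show ?thesis .
qed

lemma gw_norm_nonneg: "0 \<le> gw_norm a b \<mu>"
  by (simp add: gw_norm_def case_prod_beta)

lemma gw_norm_sm_diff:
  assumes "0 < a" "0 < b" "M \<in> finite_borel" "N \<in> finite_borel"
  shows "ennreal (gw_norm a b (sm_diff M N)) = gen_wasserstein a b M N"
  using assms by (intro gw_norm_eq) (auto simp: decompositions_def)

lemma gw_norm_uminus:
  assumes "0 < a" "0 < b"
  shows "gw_norm a b (- \<mu>) = gw_norm a b \<mu>"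
proof -
  obtain M N where \<mu>: "M \<in> finite_borel" "N \<in> finite_borel" "\<mu> = sm_diff M N"
    by (rule sm_diff_cases)
  have "ennreal (gw_norm a b (- \<mu>)) = ennreal (gw_norm a b \<mu>)"
    using assms \<mu> by (simp add: uminus_sm_diff gw_norm_sm_diff gen_wasserstein_commute[of b a M])
  then show ?thesis by (simp add: gw_norm_nonneg)
qed

text \<open>Positive measures can be scaled only by nonnegative factors; a negative sign is absorbed
  by exchanging the two parts of the decomposition.\<close>

lemma gw_norm_scaleR_le:
  assumes "0 < a" "0 < b"
  shows "gw_norm a b (r *\<^sub>R \<mu>) \<le> \<bar>r\<bar> * gw_norm a b \<mu>"
proof -
  have nonneg: "gw_norm a b (s *\<^sub>R \<mu>) \<le> s * gw_norm a b \<mu>" if "0 \<le> s" for s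
  proof -
    obtain M N where \<mu>: "M \<in> finite_borel" "N \<in> finite_borel" "\<mu> = sm_diff M N"
      by (rule sm_diff_cases)
    have "ennreal (gw_norm a b (s *\<^sub>R \<mu>)) =
        gen_wasserstein a b (scale_measure (ennreal s) M) (scale_measure (ennreal s) N)"
      using assms \<mu> that by (simp add: scale_measure_finite_borel gw_norm_sm_diff flip: sm_diff_scale_measure)
    also have "\<dots> \<le> ennreal s * gen_wasserstein a b M N"
      using assms \<mu> that by (intro gen_wasserstein_scale_le)
    also have "\<dots> = ennreal (s * gw_norm a b \<mu>)"
      using assms \<mu> that by (simp add: gw_norm_sm_diff ennreal_mult gw_norm_nonneg)
    finally show ?thesis
      using that by (simp add: gw_norm_nonneg)
  qed
  have "gw_norm a b (r *\<^sub>R \<mu>) = gw_norm a b (\<bar>r\<bar> *\<^sub>R \<mu>)"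
    using gw_norm_uminus[OF assms, of "r *\<^sub>R \<mu>"] by (auto simp: abs_if)
  then show ?thesis using nonneg[of "\<bar>r\<bar>"] by simp
qed

theorem proposition20:
  fixes a b :: real
  assumes "a > 0" and "b > 0"
  shows "(\<forall>(\<mu> :: 'a::euclidean_space signed_measure). \<forall>(M, N) \<in> decompositions \<mu>.
            ennreal (gw_norm a b \<mu>) = gen_wasserstein a b M N)
       \<and> normed_vector_space (scaleR :: real \<Rightarrow> 'a signed_measure \<Rightarrow> 'a signed_measure) (gw_norm a b)"
proof (intro conjI)
  show "\<forall>(\<mu> :: 'a signed_measure). \<forall>(M, N) \<in> decompositions \<mu>.
      ennreal (gw_norm a b \<mu>) = gen_wasserstein a b M N"
    using assms by (auto intro: gw_norm_eq)
  interpret real_vector: vector_space "scaleR :: real \<Rightarrow> 'a signed_measure \<Rightarrow> 'a signed_measure"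
    by unfold_locales (auto simp: scaleR_add_right scaleR_add_left)
  show "normed_vector_space (scaleR :: real \<Rightarrow> 'a signed_measure \<Rightarrow> 'a signed_measure) (gw_norm a b)"
  proof
    fix \<mu> \<nu> :: "'a signed_measure" and r :: real
    show "0 \<le> gw_norm a b \<mu>" by (rule gw_norm_nonneg)
    obtain M N where \<mu>: "M \<in> finite_borel" "N \<in> finite_borel" "\<mu> = sm_diff M N"
      by (rule sm_diff_cases)
    obtain M' N' where \<nu>: "M' \<in> finite_borel" "N' \<in> finite_borel" "\<nu> = sm_diff M' N'"
      by (rule sm_diff_cases)
    \<comment> \<open>For \<mu> = 0 the parts M and N need not vanish, only coincide, so
      definiteness passes through M = N.\<close>
    have "gw_norm a b \<mu> = 0 \<longleftrightarrow> ennreal (gw_norm a b \<mu>) = 0"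
      using gw_norm_nonneg[of a b \<mu>] by auto
    also have "\<dots> \<longleftrightarrow> M = N"
      using assms \<mu> by (simp add: gw_norm_sm_diff gen_wasserstein_eq_0_iff)
    also have "\<dots> \<longleftrightarrow> \<mu> = 0"
    proof
      assume "\<mu> = 0"
      then have "measure M A - measure N A = 0" for A
        using \<mu> by (metis sm_apply_sm_diff sm_apply_zero)
      then show "M = N" using \<mu> by (intro finite_borel_eqI) auto
    qed (use \<mu> in \<open>simp add: sm_diff_self\<close>)
    finally show "gw_norm a b \<mu> = 0 \<longleftrightarrow> \<mu> = 0" .
    show "gw_norm a b (r *\<^sub>R \<mu>) = \<bar>r\<bar> * gw_norm a b \<mu>"
    proof (rule antisym)
      show "\<bar>r\<bar> * gw_norm a b \<mu> \<le> gw_norm a b (r *\<^sub>R \<mu>)"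
        \<comment> \<open>The upper bound for the factor 1 / r at the point
          \<open>r *\<^sub>R \<mu>\<close> is the missing lower bound.\<close>
        using gw_norm_scaleR_le[OF assms, of "1 / r" "r *\<^sub>R \<mu>"] gw_norm_nonneg[of a b "r *\<^sub>R \<mu>"]
        by (cases "r = 0") (simp_all add: field_simps)
    qed (rule gw_norm_scaleR_le[OF assms])
    \<comment> \<open>The sums of the parts decompose \<mu> + \<nu>; since any decomposition may be
      used, subadditivity of the distance finishes the proof.\<close>
    have "ennreal (gw_norm a b (\<mu> + \<nu>)) = gen_wasserstein a b (add_measure M M') (add_measure N N')"
      using assms \<mu> \<nu> by (simp add: gw_norm_sm_diff add_measure_finite_borel flip: sm_diff_add_measure)
    also have "\<dots> \<le> gen_wasserstein a b M N + gen_wasserstein a b M' N'"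
      using assms \<mu> \<nu> by (intro gen_wasserstein_add_le)
    also have "\<dots> = ennreal (gw_norm a b \<mu> + gw_norm a b \<nu>)"
      using assms \<mu> \<nu> by (simp add: gw_norm_sm_diff gw_norm_nonneg)
    finally show "gw_norm a b (\<mu> + \<nu>) \<le> gw_norm a b \<mu> + gw_norm a b \<nu>"
      by (subst (asm) ennreal_le_iff) (simp_all add: gw_norm_nonneg)
  qed
qed

end
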